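(* Let $R$ be a ring and $n$ a non-negative integer. The class $\mathcal{WI}_{\leq n}$ of left $R$-modules of weak injective dimension at most $n$ is preenveloping, i.e. every left $R$-module has a $\mathcal{WI}_{\leq n}$-preenvelope.
   Context: Rings are associative with identity and modules are unitary. A left $R$-module $F$ is super finitely presented if there is an exact sequence $\cdots\to F_1\to F_0\to F\to 0$ with each $F_i$ finitely generated projective. The weak injective dimension $\operatorname{wid}_R(M)$ of a left $R$-module $M$ is the smallest non-negative integer $m$ such that $\operatorname{Ext}^{m+1}_R(F,M)=0$ for every super finitely presented left $R$-module $F$ (and $\infty$ if no such $m$ exists). For a class $\mathcal C$ of modules, a $\mathcal C$-preenvelope of a module $M$ is a morphism $\varphi:M\to C$ with $C\in\mathcal C$ such that every morphism $f:M\to C'$ with $C'\in\mathcal C$ factors as $f=g\varphi$ for some $g:C\to C'$. *)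

theory Defs
  imports "HOL-Algebra.Algebra" "HOL-Library.Extended_Nat"
begin

text \<open>
  The library locale \<open>module\<close> requires a commutative ring of scalars. The following is the same
  list of axioms over an arbitrary ring; the multiplication and unit fields that the record
  \<open>module\<close> inherits from \<open>ring\<close> play no role.
\<close>

locale left_module = R?: ring R + M?: abelian_group M
  for R :: "('r, 'x) ring_scheme" (structure) and M :: "('r, 'm, 'y) module_scheme" (structure) +
  assumes smult_closed [simp, intro]:
      "\<lbrakk>a \<in> carrier R; x \<in> carrier M\<rbrakk> \<Longrightarrow> a \<odot>\<^bsub>M\<^esub> x \<in> carrier M"
    and smult_l_distr:
      "\<lbrakk>a \<in> carrier R; b \<in> carrier R; x \<in> carrier M\<rbrakk> \<Longrightarrow>
        (a \<oplus>\<^bsub>R\<^esub> b) \<odot>\<^bsub>M\<^esub> x = a \<odot>\<^bsub>M\<^esub> x \<oplus>\<^bsub>M\<^esub> b \<odot>\<^bsub>M\<^esub> x"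
    and smult_r_distr:
      "\<lbrakk>a \<in> carrier R; x \<in> carrier M; y \<in> carrier M\<rbrakk> \<Longrightarrow>
        a \<odot>\<^bsub>M\<^esub> (x \<oplus>\<^bsub>M\<^esub> y) = a \<odot>\<^bsub>M\<^esub> x \<oplus>\<^bsub>M\<^esub> a \<odot>\<^bsub>M\<^esub> y"
    and smult_assoc1:
      "\<lbrakk>a \<in> carrier R; b \<in> carrier R; x \<in> carrier M\<rbrakk> \<Longrightarrow>
        (a \<otimes>\<^bsub>R\<^esub> b) \<odot>\<^bsub>M\<^esub> x = a \<odot>\<^bsub>M\<^esub> (b \<odot>\<^bsub>M\<^esub> x)"
    and smult_one [simp]:
      "x \<in> carrier M \<Longrightarrow> \<one>\<^bsub>R\<^esub> \<odot>\<^bsub>M\<^esub> x = x"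

definition mod_hom :: "'r ring \<Rightarrow> ('r, 'm) module \<Rightarrow> ('r, 'n) module \<Rightarrow> ('m \<Rightarrow> 'n) set" where
  "mod_hom R M N =
    {f \<in> hom (add_monoid M) (add_monoid N).
       \<forall>a\<in>carrier R. \<forall>x\<in>carrier M. f (a \<odot>\<^bsub>M\<^esub> x) = a \<odot>\<^bsub>N\<^esub> f x}"

definition fin_gen :: "'r ring \<Rightarrow> ('r, 'm) module \<Rightarrow> bool" where
  "fin_gen R M \<longleftrightarrow>
    (\<exists>S \<subseteq> carrier M. finite S \<and> (\<forall>H. submodule H R M \<and> S \<subseteq> H \<longrightarrow> H = carrier M))"

text \<open>
  The lifting property along surjections. A definition in HOL cannot quantify over all types, so
  the test modules \<open>A\<close> and \<open>B\<close> range over fixed types. These are large enough: \<open>B\<close> may be \<open>P\<close>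
  itself, and \<open>A\<close> may be the free module on the set \<open>carrier P\<close>, i.e. the finitely supported
  functions \<open>'p \<Rightarrow> 'r\<close>. So a module \<open>P\<close> with this property is a direct summand of a free module,
  and therefore lifts along surjections between modules of arbitrary types.
\<close>

definition projective :: "'r ring \<Rightarrow> ('r, 'p) module \<Rightarrow> bool" where
  "projective R P \<longleftrightarrow> left_module R P \<and>
    (\<forall>(A :: ('r, 'p \<Rightarrow> 'r) module) (B :: ('r, 'p) module).
       left_module R A \<and> left_module R B \<longrightarrow>
       (\<forall>g \<in> mod_hom R A B. \<forall>f \<in> mod_hom R P B. g ` carrier A = carrier B \<longrightarrow>
          (\<exists>h \<in> mod_hom R P A. \<forall>x\<in>carrier P. g (h x) = f x)))"

text \<open>
  An exact sequence \<open>\<dots> \<rightarrow> P 1 \<rightarrow> P 0 \<rightarrow> F \<rightarrow> 0\<close> with all \<open>P i\<close> projective; the maps are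
  \<open>d i : P (i + 1) \<rightarrow> P i\<close> and \<open>e : P 0 \<rightarrow> F\<close>.
\<close>

definition projective_resolution ::
    "'r ring \<Rightarrow> (nat \<Rightarrow> ('r, 'p) module) \<Rightarrow> (nat \<Rightarrow> 'p \<Rightarrow> 'p) \<Rightarrow> ('p \<Rightarrow> 'f) \<Rightarrow> ('r, 'f) module \<Rightarrow> bool"
  where
  "projective_resolution R P d e F \<longleftrightarrow>
    left_module R F \<and> (\<forall>i. projective R (P i)) \<and>
    (\<forall>i. d i \<in> mod_hom R (P (Suc i)) (P i)) \<and> e \<in> mod_hom R (P 0) F \<and>
    e ` carrier (P 0) = carrier F \<and>
    a_kernel (P 0) F e = d 0 ` carrier (P 1) \<and>
    (\<forall>i. a_kernel (P (Suc i)) (P i) (d i) = d (Suc i) ` carrier (P (Suc (Suc i))))"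

text \<open>
  Every finitely generated module is isomorphic to one with carrier in \<open>'r list\<close>: with \<open>k\<close>
  generators, represent each element by one of its coefficient vectors of length \<open>k\<close>. Hence
  taking the resolving modules on the type \<open>'r list\<close> loses nothing.
\<close>

definition super_fin_pres :: "'r ring \<Rightarrow> ('r, 'f) module \<Rightarrow> bool" where
  "super_fin_pres R F \<longleftrightarrow>
    (\<exists>(P :: nat \<Rightarrow> ('r, 'r list) module) d e.
       projective_resolution R P d e F \<and> (\<forall>i. fin_gen R (P i)))"

text \<open>
  The abelian group \<open>Hom\<^sub>R(N, M)\<close>, written as a multiplicative group record. A homomorphism is
  represented by its unique extensional representative (undefined outside \<open>carrier N\<close>).
\<close>

definition hom_group :: "'r ring \<Rightarrow> ('r, 'n) module \<Rightarrow> ('r, 'm) module \<Rightarrow> ('n \<Rightarrow> 'm) monoid" where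
  "hom_group R N M =
    \<lparr>carrier = mod_hom R N M \<inter> extensional (carrier N),
     monoid.mult = (\<lambda>f g. \<lambda>x\<in>carrier N. f x \<oplus>\<^bsub>M\<^esub> g x),
     one = (\<lambda>x\<in>carrier N. \<zero>\<^bsub>M\<^esub>)\<rparr>"

definition hom_diff :: "(nat \<Rightarrow> ('r, 'p) module) \<Rightarrow> (nat \<Rightarrow> 'p \<Rightarrow> 'p) \<Rightarrow> nat \<Rightarrow> ('p \<Rightarrow> 'm) \<Rightarrow> 'p \<Rightarrow> 'm" where
  "hom_diff P d i f = compose (carrier (P (Suc i))) f (d i)"

definition cocycles ::
    "'r ring \<Rightarrow> (nat \<Rightarrow> ('r, 'p) module) \<Rightarrow> (nat \<Rightarrow> 'p \<Rightarrow> 'p) \<Rightarrow> ('r, 'm) module \<Rightarrow> nat \<Rightarrow> ('p \<Rightarrow> 'm) set"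
  where
  "cocycles R P d M i =
    kernel (hom_group R (P i) M) (hom_group R (P (Suc i)) M) (hom_diff P d i)"

definition coboundaries ::
    "'r ring \<Rightarrow> (nat \<Rightarrow> ('r, 'p) module) \<Rightarrow> (nat \<Rightarrow> 'p \<Rightarrow> 'p) \<Rightarrow> ('r, 'm) module \<Rightarrow> nat \<Rightarrow> ('p \<Rightarrow> 'm) set"
  where
  "coboundaries R P d M i =
    (case i of 0 \<Rightarrow> {\<one>\<^bsub>hom_group R (P 0) M\<^esub>}
     | Suc j \<Rightarrow> hom_diff P d j ` carrier (hom_group R (P j) M))"

definition hom_cohomology ::
    "'r ring \<Rightarrow> (nat \<Rightarrow> ('r, 'p) module) \<Rightarrow> (nat \<Rightarrow> 'p \<Rightarrow> 'p) \<Rightarrow> ('r, 'm) module \<Rightarrow> nat \<Rightarrow>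
      ('p \<Rightarrow> 'm) set monoid"
  where
  "hom_cohomology R P d M i =
    (hom_group R (P i) M)\<lparr>carrier := cocycles R P d M i\<rparr> Mod coboundaries R P d M i"

text \<open>
  \<open>Ext\<^sup>i\<^sub>R(F, M)\<close>, computed from a chosen projective resolution of \<open>F\<close>. Every module \<open>F\<close> has a
  free resolution by modules on the type \<open>('r + 'f) list\<close>: this infinite type \<open>T\<close> admits
  injections from \<open>'f\<close>, \<open>'r\<close> and \<open>(T \<times> 'r) list\<close>, so it contains a copy of the free module on
  \<open>carrier F\<close>, and of the free module on any subset of \<open>T\<close>.
\<close>

definition Ext ::
    "'r ring \<Rightarrow> nat \<Rightarrow> ('r, 'f) module \<Rightarrow> ('r, 'm) module \<Rightarrow> (('r + 'f) list \<Rightarrow> 'm) set monoid"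
  where
  "Ext R i F M =
    (let (P, d, e) =
           (SOME (P :: nat \<Rightarrow> ('r, ('r + 'f) list) module, d, e). projective_resolution R P d e F)
     in hom_cohomology R P d M i)"

text \<open>
  As super finitely presented modules are finitely generated, it is enough to let \<open>F\<close> range over
  modules on the type \<open>'r list\<close> (see above). The infimum of the empty set is \<open>\<infinity>\<close>.
\<close>

definition wid :: "'r ring \<Rightarrow> ('r, 'm) module \<Rightarrow> enat" where
  "wid R M =
    Inf (enat ` {m. \<forall>F :: ('r, 'r list) module.
                      super_fin_pres R F \<longrightarrow> trivial_group (Ext R (m + 1) F M)})"

definition WI_le :: "'r ring \<Rightarrow> nat \<Rightarrow> ('r, 'm) module set" where
  "WI_le R n = {C. left_module R C \<and> wid R C \<le> enat n}"

text \<open>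
  A class of modules such as \<open>WI_le R n\<close> has one instance for each carrier type. In
  \<open>preenvelope R \<C> \<D> M C \<phi>\<close>, the sets \<open>\<C>\<close> and \<open>\<D>\<close> stand for the instances of one and the same
  class at the type of \<open>C\<close> and at the type of the test modules \<open>C'\<close>.
\<close>

definition preenvelope ::
    "'r ring \<Rightarrow> ('r, 'c) module set \<Rightarrow> ('r, 'd) module set \<Rightarrow>
      ('r, 'm) module \<Rightarrow> ('r, 'c) module \<Rightarrow> ('m \<Rightarrow> 'c) \<Rightarrow> bool"
  where
  "preenvelope R \<C> \<D> M C \<phi> \<longleftrightarrow>
    C \<in> \<C> \<and> \<phi> \<in> mod_hom R M C \<and>
    (\<forall>C'\<in>\<D>. \<forall>f \<in> mod_hom R M C'.
       \<exists>g \<in> mod_hom R C C'. \<forall>x\<in>carrier M. f x = g (\<phi> x))"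

text \<open>
  A carrier type for preenvelopes of modules on \<open>'m\<close>. With \<open>U = ('r + 'm) list\<close>, the elements are
  families in \<open>U\<close> indexed by all pairs of a module structure on \<open>U\<close> and a map \<open>'m \<Rightarrow> U\<close>. So the
  type holds the product of all modules \<open>N\<close> on \<open>U\<close>, one copy for each map from \<open>M\<close> to \<open>N\<close>.

  Since one HOL formula cannot quantify over the types of the test modules, "\<open>M\<close> has a preenvelope"
  is expressed by two assertions: there are \<open>C\<close> on this type and \<open>\<phi> : M \<rightarrow> C\<close> with the preenvelope
  property for test modules on this same type; and every such pair has the preenvelope property
  for test modules on an arbitrary type \<open>'d\<close>. As the first assertion does not involve \<open>'d\<close>,
  one pair \<open>(C, \<phi>)\<close> serves all types of test modules. The formula "for some \<open>C\<close> and \<open>\<phi>\<close>,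
  all test modules on \<open>'d\<close> factor" would instead allow \<open>C\<close> to depend on \<open>'d\<close>.
\<close>

type_synonym ('r, 'm) preenv =
  "('r, ('r + 'm) list) module \<times> ('m \<Rightarrow> ('r + 'm) list) \<Rightarrow> ('r + 'm) list"

end

theory Submission
  imports Defs
begin

text \<open>
  Modules of weak injective dimension at most \<open>n\<close> are closed under products and under pure submodules,
  and a map from \<open>M\<close> to any such module \<open>C'\<close> factors through a pure submodule of \<open>C'\<close> whose size is
  bounded in terms of \<open>R\<close> and \<open>M\<close>. Therefore the product of all small modules in the class, taken once
  for each map from \<open>M\<close> to them, is a preenvelope of \<open>M\<close>.

  The closure properties are seen on a resolution of a super finitely presented module \<open>F\<close> by finitely
  generated projectives \<open>P i\<close>. The group \<open>Ext\<^sup>n\<^sup>+\<^sup>1(F, M)\<close> vanishes if and only if every cocycle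
  \<open>P (n + 1) \<rightarrow> M\<close> extends along \<open>P (n + 1) \<rightarrow> P n\<close>. For a product this can be checked in each component.
  For a pure submodule, finite generation turns the search for an extension into a finite system of
  linear equations; it has a solution in the large module, hence one in the pure submodule
  (\<open>ext_vanishes_pure\<close>).

  Two facts justify working with such resolutions. By comparison of resolutions, the vanishing of
  \<open>Ext\<close> does not depend on the resolution (\<open>ext_vanishes_indep\<close>), and so not on the one chosen in its
  definition, whose modules need not be finitely generated. And since syzygies of super finitely presented
  modules are super finitely presented, \<open>wid M \<le> n\<close> means vanishing in the one degree \<open>n + 1\<close>
  (\<open>wid_le_iff\<close>). Resolutions on different types are compared by lifting along surjections of modules on
  arbitrary types, which is possible because a projective module is a summand of a free one.

  The bound on the size of the pure submodule is obtained by naming its elements: closing the image of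
  \<open>M\<close> under the module operations and under chosen solutions of solvable linear systems gives a pure
  submodule, each element of which is the value of a term. Terms are finite objects built from
  elements of \<open>R\<close> and \<open>M\<close>, so they can be written as words over \<open>'r + 'm\<close>, and the submodule has an
  isomorphic copy on the type of these words (\<open>factor_through_small\<close>).
\<close>

section \<open>Module homomorphisms\<close>

lemma mod_homI:
  assumes "\<And>x. x \<in> carrier M \<Longrightarrow> f x \<in> carrier N"
    and "\<And>x y. x \<in> carrier M \<Longrightarrow> y \<in> carrier M \<Longrightarrow> f (x \<oplus>\<^bsub>M\<^esub> y) = f x \<oplus>\<^bsub>N\<^esub> f y"
    and "\<And>a x. a \<in> carrier R \<Longrightarrow> x \<in> carrier M \<Longrightarrow> f (a \<odot>\<^bsub>M\<^esub> x) = a \<odot>\<^bsub>N\<^esub> f x"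
  shows "f \<in> mod_hom R M N"
  using assms by (auto simp: mod_hom_def hom_def)

lemma mod_hom_closed: "f \<in> mod_hom R M N \<Longrightarrow> x \<in> carrier M \<Longrightarrow> f x \<in> carrier N"
  and mod_hom_add: "f \<in> mod_hom R M N \<Longrightarrow> x \<in> carrier M \<Longrightarrow> y \<in> carrier M \<Longrightarrow>
    f (x \<oplus>\<^bsub>M\<^esub> y) = f x \<oplus>\<^bsub>N\<^esub> f y"
  and mod_hom_smult: "f \<in> mod_hom R M N \<Longrightarrow> a \<in> carrier R \<Longrightarrow> x \<in> carrier M \<Longrightarrow>
    f (a \<odot>\<^bsub>M\<^esub> x) = a \<odot>\<^bsub>N\<^esub> f x"
  by (auto simp: mod_hom_def hom_def)

lemma left_moduleI:
  assumes "ring R"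
    and "\<And>x y. \<lbrakk>x \<in> carrier M; y \<in> carrier M\<rbrakk> \<Longrightarrow> x \<oplus>\<^bsub>M\<^esub> y \<in> carrier M"
    and "\<zero>\<^bsub>M\<^esub> \<in> carrier M"
    and "\<And>x y z. \<lbrakk>x \<in> carrier M; y \<in> carrier M; z \<in> carrier M\<rbrakk> \<Longrightarrow>
      (x \<oplus>\<^bsub>M\<^esub> y) \<oplus>\<^bsub>M\<^esub> z = x \<oplus>\<^bsub>M\<^esub> (y \<oplus>\<^bsub>M\<^esub> z)"
    and "\<And>x y. \<lbrakk>x \<in> carrier M; y \<in> carrier M\<rbrakk> \<Longrightarrow> x \<oplus>\<^bsub>M\<^esub> y = y \<oplus>\<^bsub>M\<^esub> x"
    and "\<And>x. x \<in> carrier M \<Longrightarrow> \<zero>\<^bsub>M\<^esub> \<oplus>\<^bsub>M\<^esub> x = x"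
    and "\<And>x. x \<in> carrier M \<Longrightarrow> \<exists>y\<in>carrier M. y \<oplus>\<^bsub>M\<^esub> x = \<zero>\<^bsub>M\<^esub>"
    and "\<And>a x. \<lbrakk>a \<in> carrier R; x \<in> carrier M\<rbrakk> \<Longrightarrow> a \<odot>\<^bsub>M\<^esub> x \<in> carrier M"
    and "\<And>a b x. \<lbrakk>a \<in> carrier R; b \<in> carrier R; x \<in> carrier M\<rbrakk> \<Longrightarrow>
        (a \<oplus>\<^bsub>R\<^esub> b) \<odot>\<^bsub>M\<^esub> x = a \<odot>\<^bsub>M\<^esub> x \<oplus>\<^bsub>M\<^esub> b \<odot>\<^bsub>M\<^esub> x"
    and "\<And>a x y. \<lbrakk>a \<in> carrier R; x \<in> carrier M; y \<in> carrier M\<rbrakk> \<Longrightarrow>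
        a \<odot>\<^bsub>M\<^esub> (x \<oplus>\<^bsub>M\<^esub> y) = a \<odot>\<^bsub>M\<^esub> x \<oplus>\<^bsub>M\<^esub> a \<odot>\<^bsub>M\<^esub> y"
    and "\<And>a b x. \<lbrakk>a \<in> carrier R; b \<in> carrier R; x \<in> carrier M\<rbrakk> \<Longrightarrow>
        (a \<otimes>\<^bsub>R\<^esub> b) \<odot>\<^bsub>M\<^esub> x = a \<odot>\<^bsub>M\<^esub> (b \<odot>\<^bsub>M\<^esub> x)"
    and "\<And>x. x \<in> carrier M \<Longrightarrow> \<one>\<^bsub>R\<^esub> \<odot>\<^bsub>M\<^esub> x = x"
  shows "left_module R M"
  using assms by (auto intro!: left_module.intro left_module_axioms.intro abelian_groupI)

context left_module
begin

lemma smult_l_null [simp]: "x \<in> carrier M \<Longrightarrow> \<zero>\<^bsub>R\<^esub> \<odot>\<^bsub>M\<^esub> x = \<zero>\<^bsub>M\<^esub>"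
  using smult_l_distr[of "\<zero>\<^bsub>R\<^esub>" "\<zero>\<^bsub>R\<^esub>" x] by (simp add: M.add.l_cancel_one')

lemma smult_r_null [simp]: "a \<in> carrier R \<Longrightarrow> a \<odot>\<^bsub>M\<^esub> \<zero>\<^bsub>M\<^esub> = \<zero>\<^bsub>M\<^esub>"
  using smult_r_distr[of a "\<zero>\<^bsub>M\<^esub>" "\<zero>\<^bsub>M\<^esub>"] by (simp add: M.add.l_cancel_one')

lemma smult_l_minus: "a \<in> carrier R \<Longrightarrow> x \<in> carrier M \<Longrightarrow> (\<ominus>\<^bsub>R\<^esub> a) \<odot>\<^bsub>M\<^esub> x = \<ominus>\<^bsub>M\<^esub> (a \<odot>\<^bsub>M\<^esub> x)"
  using smult_l_distr[of "\<ominus>\<^bsub>R\<^esub> a" a x] by (metis M.minus_equality R.add.inv_closed R.l_neg smult_closed smult_l_null)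

lemma smult_minus_one: "x \<in> carrier M \<Longrightarrow> (\<ominus>\<^bsub>R\<^esub> \<one>\<^bsub>R\<^esub>) \<odot>\<^bsub>M\<^esub> x = \<ominus>\<^bsub>M\<^esub> x"
  by (simp add: smult_l_minus)

lemma smult_r_minus: "a \<in> carrier R \<Longrightarrow> x \<in> carrier M \<Longrightarrow> a \<odot>\<^bsub>M\<^esub> (\<ominus>\<^bsub>M\<^esub> x) = \<ominus>\<^bsub>M\<^esub> (a \<odot>\<^bsub>M\<^esub> x)"
  using smult_r_distr[of a "\<ominus>\<^bsub>M\<^esub> x" x] by (metis M.minus_equality M.add.inv_closed M.l_neg smult_closed smult_r_null)

lemma is_left_module: "left_module R M"
  by (rule left_module_axioms)

lemma submoduleI:
  assumes "H \<subseteq> carrier M" "\<zero>\<^bsub>M\<^esub> \<in> H"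
    and "\<And>x y. \<lbrakk>x \<in> H; y \<in> H\<rbrakk> \<Longrightarrow> x \<oplus>\<^bsub>M\<^esub> y \<in> H"
    and smult: "\<And>a x. \<lbrakk>a \<in> carrier R; x \<in> H\<rbrakk> \<Longrightarrow> a \<odot>\<^bsub>M\<^esub> x \<in> H"
  shows "submodule H R M"
proof -
  have "inv\<^bsub>add_monoid M\<^esub> x \<in> H" if "x \<in> H" for x
    using smult[of "\<ominus>\<^bsub>R\<^esub> \<one>\<^bsub>R\<^esub>" x] that assms(1) smult_minus_one[of x] by (auto simp: a_inv_def)
  then show ?thesis
    using assms by (auto intro!: submodule.intro subgroup.intro submodule_axioms.intro)
qed

lemma left_module_submodule:
  assumes "H \<subseteq> carrier M" "\<zero>\<^bsub>M\<^esub> \<in> H"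
    and "\<And>x y. \<lbrakk>x \<in> H; y \<in> H\<rbrakk> \<Longrightarrow> x \<oplus>\<^bsub>M\<^esub> y \<in> H"
    and smult: "\<And>a x. \<lbrakk>a \<in> carrier R; x \<in> H\<rbrakk> \<Longrightarrow> a \<odot>\<^bsub>M\<^esub> x \<in> H"
  shows "left_module R (M\<lparr>carrier := H\<rparr>)"
proof -
  have neg: "\<exists>y\<in>H. y \<oplus>\<^bsub>M\<^esub> x = \<zero>\<^bsub>M\<^esub>" if "x \<in> H" for x
    using smult[of "\<ominus>\<^bsub>R\<^esub> \<one>\<^bsub>R\<^esub>" x] that assms(1) smult_minus_one[of x] by (metis M.l_neg R.add.inv_closed R.one_closed subsetD)
  show ?thesis
    by (rule left_moduleI)
      (use assms neg in \<open>auto simp: R.ring_axioms M.a_assoc smult_l_distr smult_r_distr smult_assoc1 subset_iff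
         intro: M.a_comm\<close>)
qed

lemma smult_finsum:
  assumes "finite T" "a \<in> carrier R" "f \<in> T \<rightarrow> carrier M"
  shows "a \<odot>\<^bsub>M\<^esub> finsum M f T = finsum M (\<lambda>x. a \<odot>\<^bsub>M\<^esub> f x) T"
  using assms
proof (induction T rule: finite_induct)
  case (insert x T)
  then have "f \<in> T \<rightarrow> carrier M" "f x \<in> carrier M" by auto
  with insert show ?case
    by (subst M.finsum_insert; simp add: smult_r_distr Pi_def M.finsum_insert)
qed auto

end

lemma mod_hom_zero:
  assumes "left_module R M" "left_module R N" "f \<in> mod_hom R M N"
  shows "f \<zero>\<^bsub>M\<^esub> = \<zero>\<^bsub>N\<^esub>"
proof -
  interpret M: left_module R M by fact
  interpret N: left_module R N by fact
  have "f \<zero>\<^bsub>M\<^esub> \<oplus>\<^bsub>N\<^esub> f \<zero>\<^bsub>M\<^esub> = f \<zero>\<^bsub>M\<^esub>" "f \<zero>\<^bsub>M\<^esub> \<in> carrier N"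
    using mod_hom_add[OF assms(3), of "\<zero>\<^bsub>M\<^esub>" "\<zero>\<^bsub>M\<^esub>"] mod_hom_closed[OF assms(3)] by auto
  then show ?thesis using N.M.add.l_cancel_one by simp
qed

lemma mod_hom_minus:
  assumes "left_module R M" "left_module R N" "f \<in> mod_hom R M N" "x \<in> carrier M"
  shows "f (\<ominus>\<^bsub>M\<^esub> x) = \<ominus>\<^bsub>N\<^esub> f x"
proof -
  interpret M: left_module R M by fact
  interpret N: left_module R N by fact
  have "f (\<ominus>\<^bsub>M\<^esub> x) = f ((\<ominus>\<^bsub>R\<^esub> \<one>\<^bsub>R\<^esub>) \<odot>\<^bsub>M\<^esub> x)"
    using assms M.smult_minus_one by simp
  then show ?thesis
    using assms by (simp add: mod_hom_smult[OF assms(3)] N.smult_minus_one mod_hom_closed[OF assms(3)])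
qed

lemma mod_hom_minus_eq:
  assumes "left_module R A" "left_module R B" "f \<in> mod_hom R A B" "x \<in> carrier A" "y \<in> carrier A"
  shows "f (x \<ominus>\<^bsub>A\<^esub> y) = f x \<ominus>\<^bsub>B\<^esub> f y"
proof -
  interpret A: left_module R A by fact
  show ?thesis
    using assms mod_hom_minus[OF assms(1-3)] by (simp add: a_minus_def mod_hom_add[OF assms(3)])
qed

lemma mod_hom_comp:
  "f \<in> mod_hom R A B \<Longrightarrow> g \<in> mod_hom R B C \<Longrightarrow> (\<lambda>x. g (f x)) \<in> mod_hom R A C"
  by (auto intro!: mod_homI simp: mod_hom_closed mod_hom_add mod_hom_smult)

lemma mod_hom_id: "(\<lambda>x. x) \<in> mod_hom R A A"
  by (auto intro!: mod_homI)

lemma mod_hom_diff: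
  assumes "left_module R A" "left_module R B" "f \<in> mod_hom R A B" "g \<in> mod_hom R A B"
  shows "(\<lambda>x. f x \<ominus>\<^bsub>B\<^esub> g x) \<in> mod_hom R A B"
proof -
  interpret A: left_module R A by fact
  interpret B: left_module R B by fact
  note c = mod_hom_closed[OF assms(3)] mod_hom_closed[OF assms(4)]
  show ?thesis
    by (rule mod_homI)
      (use c in \<open>auto simp: mod_hom_add[OF assms(3)] mod_hom_add[OF assms(4)] mod_hom_smult[OF assms(3)]
        mod_hom_smult[OF assms(4)] a_minus_def B.smult_r_distr B.smult_r_minus B.M.minus_add B.M.a_ac\<close>)
qed

lemma mod_hom_finsum:
  assumes "left_module R A" "left_module R B" "h \<in> mod_hom R A B"
    and "finite T" "f \<in> T \<rightarrow> carrier A"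
  shows "h (finsum A f T) = finsum B (\<lambda>x. h (f x)) T"
  using assms(4,5)
proof (induction T rule: finite_induct)
  case empty
  interpret A: left_module R A by fact
  interpret B: left_module R B by fact
  show ?case using mod_hom_zero[OF assms(1-3)] by simp
next
  case (insert x T)
  interpret A: left_module R A by fact
  interpret B: left_module R B by fact
  have f: "f \<in> T \<rightarrow> carrier A" "f x \<in> carrier A" using insert by auto
  then have "h (finsum A f (insert x T)) = h (f x) \<oplus>\<^bsub>B\<^esub> h (finsum A f T)"
    using insert by (subst A.M.finsum_insert) (auto simp: mod_hom_add[OF assms(3)])
  also have "\<dots> = finsum B (\<lambda>x. h (f x)) (insert x T)"
    using insert f mod_hom_closed[OF assms(3)] by (subst B.M.finsum_insert) (auto simp: Pi_def)
  finally show ?case .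
qed

text \<open>The equalizer of two homomorphisms is a submodule.\<close>

lemma mod_hom_eq_on_generators:
  assumes "left_module R A" "left_module R B" "f \<in> mod_hom R A B" "g \<in> mod_hom R A B"
    and "\<And>H. submodule H R A \<Longrightarrow> S \<subseteq> H \<Longrightarrow> H = carrier A"
    and "S \<subseteq> carrier A" "\<And>x. x \<in> S \<Longrightarrow> f x = g x" "x \<in> carrier A"
  shows "f x = g x"
proof -
  interpret A: left_module R A by fact
  have "submodule {x \<in> carrier A. f x = g x} R A"
    by (rule A.submoduleI)
      (auto simp: mod_hom_zero[OF assms(1,2,3)] mod_hom_zero[OF assms(1,2,4)]
        mod_hom_add[OF assms(3)] mod_hom_add[OF assms(4)] mod_hom_smult[OF assms(3)] mod_hom_smult[OF assms(4)])
  then have "{x \<in> carrier A. f x = g x} = carrier A"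
    by (rule assms(5)) (use assms(6,7) in auto)
  then show ?thesis using assms(8) by blast
qed

section \<open>Free modules and lifting\<close>

definition free_mod :: "'r ring \<Rightarrow> 'x set \<Rightarrow> ('r, 'x \<Rightarrow> 'r) module" where
  "free_mod R E =
    \<lparr>carrier = {k. (\<forall>x\<in>E. k x \<in> carrier R) \<and> (\<forall>x. x \<notin> E \<longrightarrow> k x = \<zero>\<^bsub>R\<^esub>) \<and> finite {x. k x \<noteq> \<zero>\<^bsub>R\<^esub>}},
     monoid.mult = undefined, one = undefined,
     ring.zero = (\<lambda>x. \<zero>\<^bsub>R\<^esub>),
     add = (\<lambda>k l x. k x \<oplus>\<^bsub>R\<^esub> l x),
     smult = (\<lambda>a k x. a \<otimes>\<^bsub>R\<^esub> k x)\<rparr>"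

text \<open>The sum ranges over the support of the coefficients because a sum over an infinite set is
  only a default value.\<close>

definition lincomb :: "'r ring \<Rightarrow> ('r, 'm) module \<Rightarrow> ('x \<Rightarrow> 'm) \<Rightarrow> ('x \<Rightarrow> 'r) \<Rightarrow> 'm" where
  "lincomb R A c k = finsum A (\<lambda>x. k x \<odot>\<^bsub>A\<^esub> c x) {x. k x \<noteq> \<zero>\<^bsub>R\<^esub>}"

lemma left_module_free_mod:
  fixes R :: "'r ring"
  assumes "ring R"
  shows "left_module R (free_mod R E)"
proof -
  interpret R: ring R by fact
  have fin: "finite {x. k x \<oplus>\<^bsub>R\<^esub> l x \<noteq> \<zero>\<^bsub>R\<^esub>}"
    if "finite {x. k x \<noteq> \<zero>\<^bsub>R\<^esub>}" "finite {x. l x \<noteq> \<zero>\<^bsub>R\<^esub>}" for k l :: "'x \<Rightarrow> 'r"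
    by (rule finite_subset[OF _ finite_UnI[OF that]]) auto
  have fin': "finite {x. a \<otimes>\<^bsub>R\<^esub> k x \<noteq> \<zero>\<^bsub>R\<^esub>}"
    if "finite {x. k x \<noteq> \<zero>\<^bsub>R\<^esub>}" "a \<in> carrier R" for a and k :: "'x \<Rightarrow> 'r"
    by (rule finite_subset[OF _ that(1)]) (use that in auto)
  have cl: "k x \<in> carrier R" if "k \<in> carrier (free_mod R E)" for k x
    using that by (cases "x \<in> E") (auto simp: free_mod_def)
  have neg: "\<exists>l\<in>carrier (free_mod R E). l \<oplus>\<^bsub>free_mod R E\<^esub> k = \<zero>\<^bsub>free_mod R E\<^esub>"
    if k: "k \<in> carrier (free_mod R E)" for k
  proof -
    have "{x. \<ominus>\<^bsub>R\<^esub> k x \<noteq> \<zero>\<^bsub>R\<^esub>} \<subseteq> {x. k x \<noteq> \<zero>\<^bsub>R\<^esub>}" by auto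
    with k have "(\<lambda>x. \<ominus>\<^bsub>R\<^esub> k x) \<in> carrier (free_mod R E)"
      by (auto simp: free_mod_def intro: finite_subset)
    then show ?thesis
      by (rule bexI[rotated]) (use cl[OF k] in \<open>auto simp: free_mod_def R.l_neg\<close>)
  qed
  show ?thesis
  proof (rule left_moduleI[OF assms])
    fix k l assume k: "k \<in> carrier (free_mod R E)" and l: "l \<in> carrier (free_mod R E)"
    show "k \<oplus>\<^bsub>free_mod R E\<^esub> l \<in> carrier (free_mod R E)"
      using k l fin[of k l] by (simp add: free_mod_def)
    show "k \<oplus>\<^bsub>free_mod R E\<^esub> l = l \<oplus>\<^bsub>free_mod R E\<^esub> k"
      using cl[OF k] cl[OF l] by (simp add: free_mod_def R.a_comm)
    fix m assume m: "m \<in> carrier (free_mod R E)"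
    show "k \<oplus>\<^bsub>free_mod R E\<^esub> l \<oplus>\<^bsub>free_mod R E\<^esub> m = k \<oplus>\<^bsub>free_mod R E\<^esub> (l \<oplus>\<^bsub>free_mod R E\<^esub> m)"
      using cl[OF k] cl[OF l] cl[OF m] by (simp add: free_mod_def R.a_assoc)
  next
    fix a k l assume a: "a \<in> carrier R" and k: "k \<in> carrier (free_mod R E)" and l: "l \<in> carrier (free_mod R E)"
    show "a \<odot>\<^bsub>free_mod R E\<^esub> (k \<oplus>\<^bsub>free_mod R E\<^esub> l) =
        a \<odot>\<^bsub>free_mod R E\<^esub> k \<oplus>\<^bsub>free_mod R E\<^esub> a \<odot>\<^bsub>free_mod R E\<^esub> l"
      using a cl[OF k] cl[OF l] by (simp add: free_mod_def R.r_distr)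
  next
    fix a k assume a: "a \<in> carrier R" and k: "k \<in> carrier (free_mod R E)"
    show "a \<odot>\<^bsub>free_mod R E\<^esub> k \<in> carrier (free_mod R E)"
      using a k fin'[of k a] by (simp add: free_mod_def)
    fix b assume b: "b \<in> carrier R"
    show "(a \<oplus>\<^bsub>R\<^esub> b) \<odot>\<^bsub>free_mod R E\<^esub> k = a \<odot>\<^bsub>free_mod R E\<^esub> k \<oplus>\<^bsub>free_mod R E\<^esub> b \<odot>\<^bsub>free_mod R E\<^esub> k"
      using a b cl[OF k] by (simp add: free_mod_def R.l_distr)
    show "(a \<otimes>\<^bsub>R\<^esub> b) \<odot>\<^bsub>free_mod R E\<^esub> k = a \<odot>\<^bsub>free_mod R E\<^esub> (b \<odot>\<^bsub>free_mod R E\<^esub> k)"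
      using a b cl[OF k] by (simp add: free_mod_def R.m_assoc)
  next
    show "\<zero>\<^bsub>free_mod R E\<^esub> \<in> carrier (free_mod R E)"
      by (simp add: free_mod_def)
  next
    fix k assume k: "k \<in> carrier (free_mod R E)"
    show "\<zero>\<^bsub>free_mod R E\<^esub> \<oplus>\<^bsub>free_mod R E\<^esub> k = k" "\<one>\<^bsub>R\<^esub> \<odot>\<^bsub>free_mod R E\<^esub> k = k"
      using cl[OF k] by (simp_all add: free_mod_def)
  qed (rule neg)
qed

lemma lincomb_eq_finsum:
  assumes "left_module R A" "finite T" "{x. k x \<noteq> \<zero>\<^bsub>R\<^esub>} \<subseteq> T"
    and "\<And>x. x \<in> T \<Longrightarrow> c x \<in> carrier A" "\<And>x. x \<in> T \<Longrightarrow> k x \<in> carrier R"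
  shows "lincomb R A c k = finsum A (\<lambda>x. k x \<odot>\<^bsub>A\<^esub> c x) T"
proof -
  interpret A: left_module R A by fact
  show ?thesis unfolding lincomb_def
    by (rule A.M.add.finprod_mono_neutral_cong_left) (use assms in auto)
qed

text \<open>The universal property of the free module: prescribed images of the basis extend.\<close>

lemma lincomb_mod_hom:
  fixes R :: "'r ring"
  assumes "left_module R A" "\<And>x. x \<in> E \<Longrightarrow> c x \<in> carrier A"
  shows "lincomb R A c \<in> mod_hom R (free_mod R E) A"
proof -
  interpret A: left_module R A by fact
  interpret F: left_module R "free_mod R E" by (rule left_module_free_mod) (rule A.R.ring_axioms)
  have supp: "finite {x. k x \<noteq> \<zero>\<^bsub>R\<^esub>}" "{x. k x \<noteq> \<zero>\<^bsub>R\<^esub>} \<subseteq> E" "k x \<in> carrier R"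
    if "k \<in> carrier (free_mod R E)" for k x
    using that by (cases "x \<in> E"; auto simp: free_mod_def)+
  show ?thesis
  proof (rule mod_homI)
    fix k assume k: "k \<in> carrier (free_mod R E)"
    show "lincomb R A c k \<in> carrier A"
      unfolding lincomb_def by (rule A.M.finsum_closed) (use supp[OF k] assms in auto)
    fix a assume a: "a \<in> carrier R"
    let ?T = "{x. k x \<noteq> \<zero>\<^bsub>R\<^esub>}"
    have "lincomb R A c (a \<odot>\<^bsub>free_mod R E\<^esub> k) = finsum A (\<lambda>x. (a \<odot>\<^bsub>free_mod R E\<^esub> k) x \<odot>\<^bsub>A\<^esub> c x) ?T"
      using supp[OF k] a assms by (intro lincomb_eq_finsum) (auto simp: free_mod_def)
    also have "\<dots> = finsum A (\<lambda>x. a \<odot>\<^bsub>A\<^esub> (k x \<odot>\<^bsub>A\<^esub> c x)) ?T"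
      by (rule A.M.finsum_cong') (use supp[OF k] a assms in \<open>auto simp: free_mod_def A.smult_assoc1 subset_iff\<close>)
    also have "\<dots> = a \<odot>\<^bsub>A\<^esub> lincomb R A c k"
      unfolding lincomb_def by (rule A.smult_finsum[symmetric]) (use supp[OF k] a assms in auto)
    finally show "lincomb R A c (a \<odot>\<^bsub>free_mod R E\<^esub> k) = a \<odot>\<^bsub>A\<^esub> lincomb R A c k" .
  next
    fix k l assume k: "k \<in> carrier (free_mod R E)" and l: "l \<in> carrier (free_mod R E)"
    let ?T = "{x. k x \<noteq> \<zero>\<^bsub>R\<^esub>} \<union> {x. l x \<noteq> \<zero>\<^bsub>R\<^esub>}"
    have T: "finite ?T" "?T \<subseteq> E" using supp[OF k] supp[OF l] by auto
    have "lincomb R A c (k \<oplus>\<^bsub>free_mod R E\<^esub> l) = finsum A (\<lambda>x. (k \<oplus>\<^bsub>free_mod R E\<^esub> l) x \<odot>\<^bsub>A\<^esub> c x) ?T"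
      using T supp(3)[OF k] supp(3)[OF l] assms
      by (intro lincomb_eq_finsum) (auto simp: free_mod_def)
    also have "\<dots> = finsum A (\<lambda>x. k x \<odot>\<^bsub>A\<^esub> c x \<oplus>\<^bsub>A\<^esub> l x \<odot>\<^bsub>A\<^esub> c x) ?T"
      by (rule A.M.finsum_cong')
        (use T supp(3)[OF k] supp(3)[OF l] assms in \<open>auto simp: free_mod_def A.smult_l_distr subset_iff\<close>)
    also have "\<dots> = finsum A (\<lambda>x. k x \<odot>\<^bsub>A\<^esub> c x) ?T \<oplus>\<^bsub>A\<^esub> finsum A (\<lambda>x. l x \<odot>\<^bsub>A\<^esub> c x) ?T"
      by (rule A.M.finsum_addf) (use T supp(3)[OF k] supp(3)[OF l] assms in auto)
    also have "\<dots> = lincomb R A c k \<oplus>\<^bsub>A\<^esub> lincomb R A c l"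
      using T supp(3)[OF k] supp(3)[OF l] assms
        lincomb_eq_finsum[OF assms(1) T(1), of k c] lincomb_eq_finsum[OF assms(1) T(1), of l c]
      by (auto simp: subset_iff)
    finally show "lincomb R A c (k \<oplus>\<^bsub>free_mod R E\<^esub> l) = lincomb R A c k \<oplus>\<^bsub>A\<^esub> lincomb R A c l" .
  qed
qed

lemma mod_hom_lincomb:
  fixes R :: "'r ring"
  assumes "left_module R A" "left_module R B" "h \<in> mod_hom R A B"
    and "\<And>x. x \<in> E \<Longrightarrow> c x \<in> carrier A" "k \<in> carrier (free_mod R E)"
  shows "h (lincomb R A c k) = lincomb R B (\<lambda>x. h (c x)) k"
proof -
  interpret A: left_module R A by fact
  interpret B: left_module R B by fact
  have supp: "finite {x. k x \<noteq> \<zero>\<^bsub>R\<^esub>}" "\<And>x. k x \<noteq> \<zero>\<^bsub>R\<^esub> \<Longrightarrow> x \<in> E \<and> k x \<in> carrier R"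
    using assms(5) by (auto simp: free_mod_def)
  have "h (lincomb R A c k) = finsum B (\<lambda>x. h (k x \<odot>\<^bsub>A\<^esub> c x)) {x. k x \<noteq> \<zero>\<^bsub>R\<^esub>}"
    unfolding lincomb_def by (rule mod_hom_finsum[OF assms(1-3)]) (use supp assms in auto)
  also have "\<dots> = lincomb R B (\<lambda>x. h (c x)) k"
    unfolding lincomb_def
    by (rule B.M.finsum_cong')
      (use supp assms(4) mod_hom_closed[OF assms(3)] in \<open>auto simp: mod_hom_smult[OF assms(3)]\<close>)
  finally show ?thesis .
qed

lemma lincomb_cong:
  assumes "left_module R A" "k \<in> carrier (free_mod R E)"
    and "\<And>x. x \<in> E \<Longrightarrow> c x = c' x" "\<And>x. x \<in> E \<Longrightarrow> c' x \<in> carrier A"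
  shows "lincomb R A c k = lincomb R A c' k"
proof -
  interpret A: left_module R A by fact
  have supp: "finite {x. k x \<noteq> \<zero>\<^bsub>R\<^esub>}" "\<And>x. k x \<noteq> \<zero>\<^bsub>R\<^esub> \<Longrightarrow> x \<in> E \<and> k x \<in> carrier R"
    using assms(2) by (auto simp: free_mod_def)
  show ?thesis unfolding lincomb_def
    by (rule A.M.finsum_cong') (use supp assms in auto)
qed

text \<open>A projective module is a direct summand of the free module on its own elements. The lifting
  property gives this because the free module and \<open>P\<close> itself are among its test modules. What is
  used of projectivity below, over modules on any types, follows from the section \<open>s\<close>.\<close>

lemma projective_section:
  fixes R :: "'r ring"
  assumes "projective R P"
  obtains s where "s \<in> mod_hom R P (free_mod R (carrier P))"
    and "\<And>x. x \<in> carrier P \<Longrightarrow> lincomb R P (\<lambda>x. x) (s x) = x"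
proof -
  interpret P: left_module R P using assms by (simp add: projective_def)
  have F: "left_module R (free_mod R (carrier P))"
    by (rule left_module_free_mod) (rule P.R.ring_axioms)
  have hom: "lincomb R P (\<lambda>x. x) \<in> mod_hom R (free_mod R (carrier P)) P"
    by (rule lincomb_mod_hom) (auto simp: P.is_left_module)
  have "x \<in> lincomb R P (\<lambda>x. x) ` carrier (free_mod R (carrier P))" if x: "x \<in> carrier P" for x
  proof
    let ?k = "\<lambda>y. if y = x then \<one>\<^bsub>R\<^esub> else \<zero>\<^bsub>R\<^esub>"
    show "?k \<in> carrier (free_mod R (carrier P))"
      using x by (auto simp: free_mod_def)
    have "lincomb R P (\<lambda>x. x) ?k = finsum P (\<lambda>y. ?k y \<odot>\<^bsub>P\<^esub> y) {x}"
      by (rule lincomb_eq_finsum) (use x in \<open>auto simp: P.is_left_module\<close>)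
    also have "\<dots> = x"
      using x by (simp add: P.M.finsum_insert)
    finally show "x = lincomb R P (\<lambda>x. x) ?k" by (rule sym)
  qed
  then have "lincomb R P (\<lambda>x. x) ` carrier (free_mod R (carrier P)) = carrier P"
    using mod_hom_closed[OF hom] by blast
  then have "\<exists>s \<in> mod_hom R P (free_mod R (carrier P)). \<forall>x\<in>carrier P. lincomb R P (\<lambda>x. x) (s x) = x"
    by (rule assms[unfolded projective_def, THEN conjunct2, rule_format, OF conjI[OF F P.is_left_module] hom mod_hom_id])
  then show ?thesis using that by blast
qed

text \<open>A preimage under \<open>g\<close> is chosen for the value of \<open>f\<close> at each basis element of the free module on
  \<open>P\<close>; the homomorphism so determined is restricted to the summand \<open>P\<close>. Only the image of \<open>f\<close> has to
  be covered by \<open>g\<close>, so that maps into kernels and boundaries lift without passing to submodules.\<close>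

lemma projective_lift:
  fixes R :: "'r ring"
  assumes "projective R P" "left_module R A" "left_module R B"
    and g: "g \<in> mod_hom R A B" and f: "f \<in> mod_hom R P B"
    and sub: "\<And>x. x \<in> carrier P \<Longrightarrow> f x \<in> g ` carrier A"
  obtains h where "h \<in> mod_hom R P A" "\<And>x. x \<in> carrier P \<Longrightarrow> g (h x) = f x"
proof -
  have P: "left_module R P" using assms(1) by (simp add: projective_def)
  obtain s where s: "s \<in> mod_hom R P (free_mod R (carrier P))"
    and sec: "\<And>x. x \<in> carrier P \<Longrightarrow> lincomb R P (\<lambda>x. x) (s x) = x"
    using projective_section[OF assms(1)] by blast
  have "\<forall>x\<in>carrier P. \<exists>a\<in>carrier A. g a = f x"
    using sub by (force simp: image_iff)
  then obtain c where c: "\<And>x. x \<in> carrier P \<Longrightarrow> c x \<in> carrier A" "\<And>x. x \<in> carrier P \<Longrightarrow> g (c x) = f x"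
    by metis
  show ?thesis
  proof
    show "(\<lambda>x. lincomb R A c (s x)) \<in> mod_hom R P A"
      by (rule mod_hom_comp[OF s lincomb_mod_hom[OF assms(2)]]) (rule c)
    fix x assume x: "x \<in> carrier P"
    note sx = mod_hom_closed[OF s x]
    have "g (lincomb R A c (s x)) = lincomb R B (\<lambda>x. g (c x)) (s x)"
      by (rule mod_hom_lincomb[OF assms(2,3) g _ sx]) (rule c)
    also have "\<dots> = lincomb R B f (s x)"
      by (rule lincomb_cong[OF assms(3) sx]) (use c mod_hom_closed[OF f] in auto)
    also have "\<dots> = f (lincomb R P (\<lambda>x. x) (s x))"
      by (rule mod_hom_lincomb[OF P assms(3) f _ sx, symmetric])
    finally show "g (lincomb R A c (s x)) = f x"
      by (simp add: sec[OF x])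
  qed
qed

section \<open>Comparison of projective resolutions\<close>

lemma res_left_module: "projective_resolution R P d e F \<Longrightarrow> left_module R (P i)"
  and res_projective: "projective_resolution R P d e F \<Longrightarrow> projective R (P i)"
  and res_target: "projective_resolution R P d e F \<Longrightarrow> left_module R F"
  and res_d_hom: "projective_resolution R P d e F \<Longrightarrow> d i \<in> mod_hom R (P (Suc i)) (P i)"
  and res_e_hom: "projective_resolution R P d e F \<Longrightarrow> e \<in> mod_hom R (P 0) F"
  and res_e_surj: "projective_resolution R P d e F \<Longrightarrow> e ` carrier (P 0) = carrier F"
  by (auto simp: projective_resolution_def projective_def)

lemma res_exact_0:
  assumes "projective_resolution R P d e F" "x \<in> carrier (P 0)"
  shows "e x = \<zero>\<^bsub>F\<^esub> \<longleftrightarrow> x \<in> d 0 ` carrier (P (Suc 0))"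
proof -
  have "a_kernel (P 0) F e = d 0 ` carrier (P (Suc 0))"
    using assms(1) by (simp add: projective_resolution_def)
  then show ?thesis using assms(2) by (auto simp: a_kernel_def')
qed

lemma res_exact_Suc:
  assumes "projective_resolution R P d e F" "x \<in> carrier (P (Suc i))"
  shows "d i x = \<zero>\<^bsub>P i\<^esub> \<longleftrightarrow> x \<in> d (Suc i) ` carrier (P (Suc (Suc i)))"
proof -
  have "a_kernel (P (Suc i)) (P i) (d i) = d (Suc i) ` carrier (P (Suc (Suc i)))"
    using assms(1) by (simp add: projective_resolution_def)
  then show ?thesis using assms(2) by (auto simp: a_kernel_def')
qed

lemma res_e_d:
  assumes "projective_resolution R P d e F" "x \<in> carrier (P (Suc 0))"
  shows "e (d 0 x) = \<zero>\<^bsub>F\<^esub>"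
  using res_exact_0[OF assms(1), of "d 0 x"] mod_hom_closed[OF res_d_hom[OF assms(1)]] assms(2) by auto

lemma res_d_d:
  assumes "projective_resolution R P d e F" "x \<in> carrier (P (Suc (Suc i)))"
  shows "d i (d (Suc i) x) = \<zero>\<^bsub>P i\<^esub>"
  using res_exact_Suc[OF assms(1), of "d (Suc i) x" i] mod_hom_closed[OF res_d_hom[OF assms(1)]] assms(2)
  by auto

text \<open>The inductive construction needs to know of the map in degree \<open>i\<close> only that it carries
  boundaries to boundaries. This condition does not mention degree \<open>i - 1\<close>, so the augmentation
  enters in degree \<open>0\<close> alone.\<close>

lemma chain_map_exists:
  fixes P :: "nat \<Rightarrow> ('r, 'p) module" and Q :: "nat \<Rightarrow> ('r, 'q) module"
  assumes P: "projective_resolution R P d e F" and Q: "projective_resolution R Q d' e' F"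
  obtains \<alpha> where "\<And>i. \<alpha> i \<in> mod_hom R (Q i) (P i)"
    and "\<And>x. x \<in> carrier (Q 0) \<Longrightarrow> e (\<alpha> 0 x) = e' x"
    and "\<And>i x. x \<in> carrier (Q (Suc i)) \<Longrightarrow> d i (\<alpha> (Suc i) x) = \<alpha> i (d' i x)"
proof -
  define Inv where "Inv i a \<longleftrightarrow> a \<in> mod_hom R (Q i) (P i) \<and>
      (i = 0 \<longrightarrow> (\<forall>x\<in>carrier (Q i). e (a x) = e' x)) \<and>
      (\<forall>x\<in>carrier (Q (Suc i)). a (d' i x) \<in> d i ` carrier (P (Suc i)))" for i a
  note dcl = mod_hom_closed[OF res_d_hom[OF P]] mod_hom_closed[OF res_d_hom[OF Q]]
  have "\<exists>\<alpha>. \<forall>i. Inv i (\<alpha> i) \<and> (\<forall>x\<in>carrier (Q (Suc i)). d i (\<alpha> (Suc i) x) = \<alpha> i (d' i x))"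
  proof (rule dependent_nat_choice)
    have sub: "e' x \<in> e ` carrier (P 0)" if "x \<in> carrier (Q 0)" for x
      using that res_e_surj[OF P] res_e_surj[OF Q] by auto
    obtain a where a: "a \<in> mod_hom R (Q 0) (P 0)" and ea: "\<And>x. x \<in> carrier (Q 0) \<Longrightarrow> e (a x) = e' x"
      using projective_lift[OF res_projective[OF Q] res_left_module[OF P] res_target[OF P]
        res_e_hom[OF P] res_e_hom[OF Q] sub] by blast
    have "a (d' 0 x) \<in> d 0 ` carrier (P (Suc 0))" if "x \<in> carrier (Q (Suc 0))" for x
      using res_exact_0[OF P, of "a (d' 0 x)"] ea[of "d' 0 x"] res_e_d[OF Q that] that dcl(2) mod_hom_closed[OF a]
      by auto
    with a ea show "\<exists>a. Inv 0 a" unfolding Inv_def by blast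
  next
    fix a i assume "Inv i a"
    then have a: "a \<in> mod_hom R (Q i) (P i)"
      and bd: "\<And>x. x \<in> carrier (Q (Suc i)) \<Longrightarrow> a (d' i x) \<in> d i ` carrier (P (Suc i))"
      by (auto simp: Inv_def)
    obtain b where b: "b \<in> mod_hom R (Q (Suc i)) (P (Suc i))"
      and db: "\<And>x. x \<in> carrier (Q (Suc i)) \<Longrightarrow> d i (b x) = a (d' i x)"
      using projective_lift[OF res_projective[OF Q] res_left_module[OF P] res_left_module[OF P]
        res_d_hom[OF P] mod_hom_comp[OF res_d_hom[OF Q] a] bd] by blast
    have "b (d' (Suc i) x) \<in> d (Suc i) ` carrier (P (Suc (Suc i)))" if x: "x \<in> carrier (Q (Suc (Suc i)))" for x
    proof -
      have "d i (b (d' (Suc i) x)) = a \<zero>\<^bsub>Q i\<^esub>"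
        using db[of "d' (Suc i) x"] res_d_d[OF Q x] dcl(2)[OF x] by simp
      also have "\<dots> = \<zero>\<^bsub>P i\<^esub>"
        by (rule mod_hom_zero[OF res_left_module[OF Q] res_left_module[OF P] a])
      finally show ?thesis
        using res_exact_Suc[OF P] mod_hom_closed[OF b] dcl(2)[OF x] by blast
    qed
    with b db show "\<exists>b. Inv (Suc i) b \<and> (\<forall>x\<in>carrier (Q (Suc i)). d i (b x) = a (d' i x))"
      unfolding Inv_def by blast
  qed
  then obtain \<alpha> where "\<And>i. Inv i (\<alpha> i)"
    and "\<And>i x. x \<in> carrier (Q (Suc i)) \<Longrightarrow> d i (\<alpha> (Suc i) x) = \<alpha> i (d' i x)"
    by blast
  then show ?thesis
    by (intro that[of \<alpha>]) (simp_all add: Inv_def)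
qed

text \<open>As for chain maps, the invariant of the induction is stated so that degree \<open>i + 1\<close> needs only
  the component in degree \<open>i\<close>: on boundaries, \<open>d i \<circ> h i\<close> must already agree with \<open>\<gamma> i\<close>.\<close>

lemma null_homotopy_exists:
  fixes Q :: "nat \<Rightarrow> ('r, 'q) module"
  assumes Q: "projective_resolution R Q d e F"
    and \<gamma>: "\<And>i. \<gamma> i \<in> mod_hom R (Q i) (Q i)"
    and \<gamma>0: "\<And>x. x \<in> carrier (Q 0) \<Longrightarrow> e (\<gamma> 0 x) = \<zero>\<^bsub>F\<^esub>"
    and \<gamma>d: "\<And>i x. x \<in> carrier (Q (Suc i)) \<Longrightarrow> d i (\<gamma> (Suc i) x) = \<gamma> i (d i x)"
  obtains h where "\<And>i. h i \<in> mod_hom R (Q i) (Q (Suc i))"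
    and "\<And>i x. x \<in> carrier (Q (Suc i)) \<Longrightarrow> d (Suc i) (h (Suc i) x) = \<gamma> (Suc i) x \<ominus>\<^bsub>Q (Suc i)\<^esub> h i (d i x)"
proof -
  define Inv where "Inv i a \<longleftrightarrow> a \<in> mod_hom R (Q i) (Q (Suc i)) \<and>
      (\<forall>x\<in>carrier (Q (Suc i)). d i (a (d i x)) = \<gamma> i (d i x))" for i a
  note dh = res_d_hom[OF Q]
  note dcl = mod_hom_closed[OF dh]
  note lm = res_left_module[OF Q]
  have "\<exists>h. \<forall>i. Inv i (h i) \<and> (\<forall>x\<in>carrier (Q (Suc i)).
      d (Suc i) (h (Suc i) x) = \<gamma> (Suc i) x \<ominus>\<^bsub>Q (Suc i)\<^esub> h i (d i x))"
  proof (rule dependent_nat_choice)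
    have sub: "\<gamma> 0 x \<in> d 0 ` carrier (Q (Suc 0))" if "x \<in> carrier (Q 0)" for x
      using res_exact_0[OF Q, of "\<gamma> 0 x"] \<gamma>0[OF that] mod_hom_closed[OF \<gamma> that] by simp
    obtain a where "a \<in> mod_hom R (Q 0) (Q (Suc 0))" "\<And>x. x \<in> carrier (Q 0) \<Longrightarrow> d 0 (a x) = \<gamma> 0 x"
      using projective_lift[OF res_projective[OF Q] lm lm dh \<gamma> sub] by blast
    then show "\<exists>a. Inv 0 a" unfolding Inv_def using dcl by blast
  next
    fix a i assume "Inv i a"
    then have a: "a \<in> mod_hom R (Q i) (Q (Suc i))"
      and da: "\<And>x. x \<in> carrier (Q (Suc i)) \<Longrightarrow> d i (a (d i x)) = \<gamma> i (d i x)"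
      by (auto simp: Inv_def)
    interpret Qi: left_module R "Q i" by (rule lm)
    interpret Qi': left_module R "Q (Suc i)" by (rule lm)
    let ?c = "\<lambda>x. \<gamma> (Suc i) x \<ominus>\<^bsub>Q (Suc i)\<^esub> a (d i x)"
    have c: "?c \<in> mod_hom R (Q (Suc i)) (Q (Suc i))"
      by (rule mod_hom_diff[OF lm lm \<gamma> mod_hom_comp[OF dh a]])
    have cyc: "?c x \<in> d (Suc i) ` carrier (Q (Suc (Suc i)))" if x: "x \<in> carrier (Q (Suc i))" for x
    proof -
      note cl = mod_hom_closed[OF \<gamma> x] mod_hom_closed[OF a dcl[OF x]] mod_hom_closed[OF \<gamma> dcl[OF x]]
      have "d i (?c x) = d i (\<gamma> (Suc i) x) \<oplus>\<^bsub>Q i\<^esub> \<ominus>\<^bsub>Q i\<^esub> d i (a (d i x))"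
        using cl by (simp add: a_minus_def mod_hom_add[OF dh] mod_hom_minus[OF lm lm dh])
      also have "\<dots> = \<zero>\<^bsub>Q i\<^esub>"
        using cl by (simp add: \<gamma>d[OF x] da[OF x] Qi.M.r_neg)
      finally show ?thesis
        using res_exact_Suc[OF Q mod_hom_closed[OF c x]] by blast
    qed
    obtain b where b: "b \<in> mod_hom R (Q (Suc i)) (Q (Suc (Suc i)))"
      and db: "\<And>x. x \<in> carrier (Q (Suc i)) \<Longrightarrow> d (Suc i) (b x) = ?c x"
      using projective_lift[OF res_projective[OF Q] lm lm dh c cyc] by blast
    have "d (Suc i) (b (d (Suc i) x)) = \<gamma> (Suc i) (d (Suc i) x)" if x: "x \<in> carrier (Q (Suc (Suc i)))" for x
    proof -
      have "d (Suc i) (b (d (Suc i) x)) = \<gamma> (Suc i) (d (Suc i) x) \<ominus>\<^bsub>Q (Suc i)\<^esub> a \<zero>\<^bsub>Q i\<^esub>"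
        using db[OF dcl[OF x]] res_d_d[OF Q x] by simp
      also have "\<dots> = \<gamma> (Suc i) (d (Suc i) x)"
        using mod_hom_closed[OF \<gamma> dcl[OF x]] by (simp add: mod_hom_zero[OF lm lm a] a_minus_def)
      finally show ?thesis .
    qed
    with b db show "\<exists>b. Inv (Suc i) b \<and> (\<forall>x\<in>carrier (Q (Suc i)). d (Suc i) (b x) = ?c x)"
      unfolding Inv_def by blast
  qed
  then obtain h where "\<And>i. Inv i (h i)"
    and "\<And>i x. x \<in> carrier (Q (Suc i)) \<Longrightarrow>
      d (Suc i) (h (Suc i) x) = \<gamma> (Suc i) x \<ominus>\<^bsub>Q (Suc i)\<^esub> h i (d i x)"
    by blast
  then show ?thesis
    by (intro that[of h]) (simp_all add: Inv_def)
qed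

text \<open>For a projective resolution of \<open>F\<close>, this says \<open>Ext\<^sup>i\<^sup>+\<^sup>1(F, M) = 0\<close>. The shift by one spares a
  special case: in positive degrees every coboundary is some \<open>g \<circ> d i\<close>, and the weak injective
  dimension concerns positive degrees only.\<close>

definition ext_vanishes ::
    "'r ring \<Rightarrow> (nat \<Rightarrow> ('r, 'p) module) \<Rightarrow> (nat \<Rightarrow> 'p \<Rightarrow> 'p) \<Rightarrow> ('r, 'm) module \<Rightarrow> nat \<Rightarrow> bool"
  where
  "ext_vanishes R P d M i \<longleftrightarrow>
    (\<forall>f\<in>mod_hom R (P (Suc i)) M.
       (\<forall>x\<in>carrier (P (Suc (Suc i))). f (d (Suc i) x) = \<zero>\<^bsub>M\<^esub>) \<longrightarrow>
       (\<exists>g\<in>mod_hom R (P i) M. \<forall>x\<in>carrier (P (Suc i)). f x = g (d i x)))"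

lemma ext_vanishesI:
  assumes "\<And>f. f \<in> mod_hom R (P (Suc i)) M \<Longrightarrow>
      (\<And>x. x \<in> carrier (P (Suc (Suc i))) \<Longrightarrow> f (d (Suc i) x) = \<zero>\<^bsub>M\<^esub>) \<Longrightarrow>
      \<exists>g\<in>mod_hom R (P i) M. \<forall>x\<in>carrier (P (Suc i)). f x = g (d i x)"
  shows "ext_vanishes R P d M i"
  using assms by (simp add: ext_vanishes_def)

lemma ext_vanishesD:
  assumes "ext_vanishes R P d M i" "f \<in> mod_hom R (P (Suc i)) M"
    and "\<And>x. x \<in> carrier (P (Suc (Suc i))) \<Longrightarrow> f (d (Suc i) x) = \<zero>\<^bsub>M\<^esub>"
  obtains g where "g \<in> mod_hom R (P i) M" "\<And>x. x \<in> carrier (P (Suc i)) \<Longrightarrow> f x = g (d i x)"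
  using assms unfolding ext_vanishes_def by blast

lemma (in abelian_group) diff_diff_eq_zero:
  assumes "x \<in> carrier G" "y \<in> carrier G" "z \<in> carrier G" "(x \<ominus> y) \<ominus> z = \<zero>"
  shows "y = x \<ominus> z"
proof -
  have "(x \<ominus> z) \<ominus> y = (x \<ominus> y) \<ominus> z"
    using assms(1-3) by (simp add: a_minus_def a_assoc a_comm[of "\<ominus> y"])
  then have "(x \<ominus> z) \<oplus> \<ominus> y = \<zero>"
    using assms(4) by (simp add: a_minus_def)
  then show ?thesis
    using assms minus_equality[of "x \<ominus> z" "\<ominus> y"] by simp
qed

text \<open>Let \<open>\<alpha> : Q \<rightarrow> P\<close> and \<open>\<beta> : P \<rightarrow> Q\<close> be chain maps over the identity of \<open>F\<close>, and \<open>h\<close> a homotopy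
  between \<open>\<beta> \<circ> \<alpha>\<close> and the identity. For a cocycle \<open>f\<close> on \<open>Q\<close>, the cocycle \<open>f \<circ> \<beta>\<close> on \<open>P\<close> is some
  \<open>g \<circ> d\<close>. Then \<open>f = f \<circ> \<beta> \<circ> \<alpha> - f \<circ> h \<circ> d' = (g \<circ> \<alpha> - f \<circ> h) \<circ> d'\<close>.\<close>

lemma ext_vanishes_indep:
  fixes P :: "nat \<Rightarrow> ('r, 'p) module" and Q :: "nat \<Rightarrow> ('r, 'q) module"
  assumes P: "projective_resolution R P d e F" and Q: "projective_resolution R Q d' e' F"
    and M: "left_module R M" and vanish: "ext_vanishes R P d M i"
  shows "ext_vanishes R Q d' M i"
proof -
  note lQ = res_left_module[OF Q]
  note dQ = res_d_hom[OF Q] and dP = res_d_hom[OF P]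
  interpret M: left_module R M by fact
  obtain \<alpha> where \<alpha>: "\<And>i. \<alpha> i \<in> mod_hom R (Q i) (P i)"
    and e\<alpha>: "\<And>x. x \<in> carrier (Q 0) \<Longrightarrow> e (\<alpha> 0 x) = e' x"
    and d\<alpha>: "\<And>i x. x \<in> carrier (Q (Suc i)) \<Longrightarrow> d i (\<alpha> (Suc i) x) = \<alpha> i (d' i x)"
    using chain_map_exists[OF P Q] by blast
  obtain \<beta> where \<beta>: "\<And>i. \<beta> i \<in> mod_hom R (P i) (Q i)"
    and e\<beta>: "\<And>x. x \<in> carrier (P 0) \<Longrightarrow> e' (\<beta> 0 x) = e x"
    and d\<beta>: "\<And>i x. x \<in> carrier (P (Suc i)) \<Longrightarrow> d' i (\<beta> (Suc i) x) = \<beta> i (d i x)"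
    using chain_map_exists[OF Q P] by blast
  note cl = mod_hom_closed[OF \<alpha>] mod_hom_closed[OF \<beta>] mod_hom_closed[OF dQ] mod_hom_closed[OF dP]
  define \<gamma> where "\<gamma> = (\<lambda>i x. \<beta> i (\<alpha> i x) \<ominus>\<^bsub>Q i\<^esub> x)"
  have \<gamma>: "\<gamma> i \<in> mod_hom R (Q i) (Q i)" for i
    unfolding \<gamma>_def by (rule mod_hom_diff[OF lQ lQ mod_hom_comp[OF \<alpha> \<beta>] mod_hom_id])
  have \<gamma>0: "e' (\<gamma> 0 x) = \<zero>\<^bsub>F\<^esub>" if x: "x \<in> carrier (Q 0)" for x
  proof -
    interpret F: left_module R F by (rule res_target[OF Q])
    have "e' (\<gamma> 0 x) = e' (\<beta> 0 (\<alpha> 0 x)) \<ominus>\<^bsub>F\<^esub> e' x"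
      using x cl by (simp add: \<gamma>_def mod_hom_minus_eq[OF lQ res_target[OF Q] res_e_hom[OF Q]])
    also have "\<dots> = \<zero>\<^bsub>F\<^esub>"
      using x cl mod_hom_closed[OF res_e_hom[OF Q] x] by (simp add: e\<beta> e\<alpha> a_minus_def F.M.r_neg)
    finally show ?thesis .
  qed
  have \<gamma>d: "d' i (\<gamma> (Suc i) x) = \<gamma> i (d' i x)" if x: "x \<in> carrier (Q (Suc i))" for i x
  proof -
    have "\<beta> (Suc i) (\<alpha> (Suc i) x) \<in> carrier (Q (Suc i))"
      by (rule mod_hom_closed[OF \<beta> mod_hom_closed[OF \<alpha> x]])
    then have "d' i (\<gamma> (Suc i) x) = d' i (\<beta> (Suc i) (\<alpha> (Suc i) x)) \<ominus>\<^bsub>Q i\<^esub> d' i x"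
      unfolding \<gamma>_def by (rule mod_hom_minus_eq[OF lQ lQ dQ _ x])
    also have "d' i (\<beta> (Suc i) (\<alpha> (Suc i) x)) = \<beta> i (d i (\<alpha> (Suc i) x))"
      by (rule d\<beta>[OF mod_hom_closed[OF \<alpha> x]])
    also have "d i (\<alpha> (Suc i) x) = \<alpha> i (d' i x)"
      by (rule d\<alpha>[OF x])
    finally show ?thesis by (simp only: \<gamma>_def)
  qed
  obtain h where h: "\<And>i. h i \<in> mod_hom R (Q i) (Q (Suc i))"
    and dh: "\<And>i x. x \<in> carrier (Q (Suc i)) \<Longrightarrow>
      d' (Suc i) (h (Suc i) x) = \<gamma> (Suc i) x \<ominus>\<^bsub>Q (Suc i)\<^esub> h i (d' i x)"
    using null_homotopy_exists[OF Q \<gamma> \<gamma>0 \<gamma>d] by metis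
  show ?thesis
  proof (rule ext_vanishesI)
    fix f assume f: "f \<in> mod_hom R (Q (Suc i)) M"
      and cocycle: "\<And>x. x \<in> carrier (Q (Suc (Suc i))) \<Longrightarrow> f (d' (Suc i) x) = \<zero>\<^bsub>M\<^esub>"
    have "f (\<beta> (Suc i) (d (Suc i) x)) = \<zero>\<^bsub>M\<^esub>" if "x \<in> carrier (P (Suc (Suc i)))" for x
      using cocycle cl that by (simp add: d\<beta>[symmetric])
    then obtain g where g: "g \<in> mod_hom R (P i) M"
      and fg: "\<And>x. x \<in> carrier (P (Suc i)) \<Longrightarrow> f (\<beta> (Suc i) x) = g (d i x)"
      using ext_vanishesD[OF vanish mod_hom_comp[OF \<beta> f]] by metis
    let ?g = "\<lambda>x. g (\<alpha> i x) \<ominus>\<^bsub>M\<^esub> f (h i x)"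
    have "?g \<in> mod_hom R (Q i) M"
      by (rule mod_hom_diff[OF lQ M mod_hom_comp[OF \<alpha> g] mod_hom_comp[OF h f]])
    moreover have "f x = ?g (d' i x)" if x: "x \<in> carrier (Q (Suc i))" for x
    proof -
      interpret Q: left_module R "Q (Suc i)" by (rule lQ)
      note hcl = mod_hom_closed[OF h] and fcl = mod_hom_closed[OF f]
      have cl': "\<beta> (Suc i) (\<alpha> (Suc i) x) \<in> carrier (Q (Suc i))" "h i (d' i x) \<in> carrier (Q (Suc i))"
        by (rule cl(2)[OF cl(1)[OF x]], rule hcl[OF cl(3)[OF x]])
      have "\<zero>\<^bsub>M\<^esub> = f (d' (Suc i) (h (Suc i) x))"
        by (rule cocycle[OF hcl[OF x], symmetric])
      also have "\<dots> = (f (\<beta> (Suc i) (\<alpha> (Suc i) x)) \<ominus>\<^bsub>M\<^esub> f x) \<ominus>\<^bsub>M\<^esub> f (h i (d' i x))"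
        using x cl' by (simp add: dh \<gamma>_def mod_hom_minus_eq[OF lQ M f])
      also have "f (\<beta> (Suc i) (\<alpha> (Suc i) x)) = g (\<alpha> i (d' i x))"
        by (simp only: fg[OF cl(1)[OF x]] d\<alpha>[OF x])
      finally have z: "(g (\<alpha> i (d' i x)) \<ominus>\<^bsub>M\<^esub> f x) \<ominus>\<^bsub>M\<^esub> f (h i (d' i x)) = \<zero>\<^bsub>M\<^esub>" by (rule sym)
      have mcl: "g (\<alpha> i (d' i x)) \<in> carrier M" "f x \<in> carrier M" "f (h i (d' i x)) \<in> carrier M"
        by (rule mod_hom_closed[OF g cl(1)[OF cl(3)[OF x]]], rule fcl[OF x], rule fcl[OF cl'(2)])
      show ?thesis
        by (rule M.M.diff_diff_eq_zero[OF mcl z])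
    qed
    ultimately show "\<exists>g\<in>mod_hom R (Q i) M. \<forall>x\<in>carrier (Q (Suc i)). f x = g (d' i x)"
      by (intro bexI[of _ ?g] ballI)
  qed
qed

section \<open>Transport of structure\<close>

definition transport_mod :: "('a \<Rightarrow> 'b) \<Rightarrow> ('r, 'a) module \<Rightarrow> ('r, 'b) module" where
  "transport_mod j A =
    \<lparr>carrier = j ` carrier A, monoid.mult = undefined, one = undefined,
     ring.zero = j \<zero>\<^bsub>A\<^esub>,
     add = (\<lambda>x y. j (inv_into (carrier A) j x \<oplus>\<^bsub>A\<^esub> inv_into (carrier A) j y)),
     smult = (\<lambda>a x. j (a \<odot>\<^bsub>A\<^esub> inv_into (carrier A) j x))\<rparr>"

lemma left_module_transport_mod:
  assumes A: "left_module R A" and j: "inj_on j (carrier A)"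
  shows "left_module R (transport_mod j A)"
proof -
  interpret A: left_module R A by fact
  let ?T = "transport_mod j A"
  have add: "j x \<oplus>\<^bsub>?T\<^esub> j y = j (x \<oplus>\<^bsub>A\<^esub> y)" if "x \<in> carrier A" "y \<in> carrier A" for x y
    using that j by (simp add: transport_mod_def)
  have smult: "a \<odot>\<^bsub>?T\<^esub> j x = j (a \<odot>\<^bsub>A\<^esub> x)" if "x \<in> carrier A" for a x
    using that j by (simp add: transport_mod_def)
  have neg: "\<exists>y\<in>carrier ?T. y \<oplus>\<^bsub>?T\<^esub> j x = \<zero>\<^bsub>?T\<^esub>" if x: "x \<in> carrier A" for x
  proof (rule bexI[of _ "j (\<ominus>\<^bsub>A\<^esub> x)"])
    show "j (\<ominus>\<^bsub>A\<^esub> x) \<oplus>\<^bsub>?T\<^esub> j x = \<zero>\<^bsub>?T\<^esub>"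
      using x by (simp add: add A.M.l_neg) (simp add: transport_mod_def)
  qed (use x in \<open>simp add: transport_mod_def\<close>)
  have carrier: "carrier ?T = j ` carrier A" and zero: "\<zero>\<^bsub>?T\<^esub> = j \<zero>\<^bsub>A\<^esub>"
    by (simp_all add: transport_mod_def)
  show ?thesis
  proof (rule left_moduleI[OF A.R.ring_axioms], unfold carrier zero)
    show "\<And>x. x \<in> j ` carrier A \<Longrightarrow> \<exists>y\<in>j ` carrier A. y \<oplus>\<^bsub>?T\<^esub> x = j \<zero>\<^bsub>A\<^esub>"
      using neg unfolding carrier zero by blast
  qed (auto simp: add smult A.M.a_ac A.smult_l_distr A.smult_r_distr A.smult_assoc1)
qed

lemma transport_mod_hom:
  assumes "inj_on j (carrier A)"
  shows "j \<in> mod_hom R A (transport_mod j A)"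
  by (rule mod_homI) (use assms in \<open>simp_all add: transport_mod_def\<close>)

lemma transport_mod_hom_inv:
  assumes "left_module R A" "inj_on j (carrier A)"
  shows "inv_into (carrier A) j \<in> mod_hom R (transport_mod j A) A"
proof -
  interpret A: left_module R A by fact
  show ?thesis
    by (rule mod_homI) (use assms(2) in \<open>auto simp: transport_mod_def\<close>)
qed

lemma projective_transport_mod:
  fixes R :: "'r ring"
  assumes P: "projective R P" and j: "inj_on j (carrier P)"
  shows "projective R (transport_mod j P)"
proof -
  have lP: "left_module R P" using P by (simp add: projective_def)
  note hom = transport_mod_hom[OF j, of R] and hom' = transport_mod_hom_inv[OF lP j]
  show ?thesis
    unfolding projective_def
  proof (intro conjI allI impI ballI)
    show "left_module R (transport_mod j P)" by (rule left_module_transport_mod[OF lP j])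
    fix A :: "('r, 'b \<Rightarrow> 'r) module" and B :: "('r, 'b) module" and g f
    assume AB: "left_module R A \<and> left_module R B" and g: "g \<in> mod_hom R A B"
      and f: "f \<in> mod_hom R (transport_mod j P) B" and onto: "g ` carrier A = carrier B"
    note fj = mod_hom_comp[OF hom f]
    have sub: "f (j x) \<in> g ` carrier A" if "x \<in> carrier P" for x
      using mod_hom_closed[OF fj that] onto by simp
    obtain h where h: "h \<in> mod_hom R P A" and gh: "\<And>x. x \<in> carrier P \<Longrightarrow> g (h x) = f (j x)"
      using projective_lift[OF P conjunct1[OF AB] conjunct2[OF AB] g fj sub] by metis
    show "\<exists>h\<in>mod_hom R (transport_mod j P) A. \<forall>x\<in>carrier (transport_mod j P). g (h x) = f x"
    proof (intro bexI[of _ "\<lambda>x. h (inv_into (carrier P) j x)"] ballI)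
      show "(\<lambda>x. h (inv_into (carrier P) j x)) \<in> mod_hom R (transport_mod j P) A"
        by (rule mod_hom_comp[OF hom' h])
      fix x assume "x \<in> carrier (transport_mod j P)"
      then obtain y where "y \<in> carrier P" "x = j y" by (auto simp: transport_mod_def)
      then show "g (h (inv_into (carrier P) j x)) = f x"
        using j by (simp add: gh)
    qed
  qed
qed

text \<open>Resolutions move to any type into which the given one injects. This yields resolutions on the
  type from which \<open>Ext\<close> chooses.\<close>

lemma projective_resolution_transport:
  fixes j :: "'p \<Rightarrow> 'q"
  assumes res: "projective_resolution R P d e F" and j: "inj j"
  shows "projective_resolution R (\<lambda>i. transport_mod j (P i)) (\<lambda>i x. j (d i (inv_into UNIV j x))) (\<lambda>x. e (inv_into UNIV j x)) F"
proof -
  have inj: "inj_on j A" for A using j by (rule inj_on_subset) simp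
  have carrier: "carrier (transport_mod j A) = j ` carrier A"
    and zero: "\<zero>\<^bsub>transport_mod j A\<^esub> = j \<zero>\<^bsub>A\<^esub>" for A :: "('a, 'p) module"
    by (simp_all add: transport_mod_def)
  have inv: "inv_into (carrier A) j x = inv_into UNIV j x" if "x \<in> carrier (transport_mod j A)" for A :: "('a, 'p) module" and x
    using that j inj[of "carrier A"] by (auto simp: carrier)
  have hom: "(\<lambda>x. f (inv_into UNIV j x)) \<in> mod_hom R (transport_mod j (P i)) B" if f: "f \<in> mod_hom R (P i) B" for f i and B :: "('a, 'c) module"
  proof -
    have *: "(\<lambda>x. f (inv_into (carrier (P i)) j x)) \<in> mod_hom R (transport_mod j (P i)) B"
      by (rule mod_hom_comp[OF transport_mod_hom_inv[OF res_left_module[OF res] inj] f])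
    interpret T: left_module R "transport_mod j (P i)"
      by (rule left_module_transport_mod[OF res_left_module[OF res] inj])
    show ?thesis
      by (rule mod_homI)
       (use mod_hom_closed[OF *] mod_hom_add[OF *] mod_hom_smult[OF *] inv[of _ "P i"] in simp_all)
  qed
  show ?thesis
    unfolding projective_resolution_def
  proof (intro conjI allI)
    fix i
    show "projective R (transport_mod j (P i))"
      by (rule projective_transport_mod[OF res_projective[OF res] inj])
    show "(\<lambda>x. j (d i (inv_into UNIV j x))) \<in> mod_hom R (transport_mod j (P (Suc i))) (transport_mod j (P i))"
      by (rule hom[OF mod_hom_comp[OF res_d_hom[OF res] transport_mod_hom[OF inj]]])
    show "a_kernel (transport_mod j (P (Suc i))) (transport_mod j (P i)) (\<lambda>x. j (d i (inv_into UNIV j x))) =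
        (\<lambda>x. j (d (Suc i) (inv_into UNIV j x))) ` carrier (transport_mod j (P (Suc (Suc i))))"
      using res_exact_Suc[OF res] mod_hom_closed[OF res_d_hom[OF res]] j
      by (auto simp: a_kernel_def' carrier zero image_image inj_eq)
  next
    show "(\<lambda>x. e (inv_into UNIV j x)) \<in> mod_hom R (transport_mod j (P 0)) F"
      by (rule hom[OF res_e_hom[OF res]])
    show "(\<lambda>x. e (inv_into UNIV j x)) ` carrier (transport_mod j (P 0)) = carrier F"
      using res_e_surj[OF res] j by (simp add: carrier image_image)
    show "a_kernel (transport_mod j (P 0)) F (\<lambda>x. e (inv_into UNIV j x)) =
        (\<lambda>x. j (d 0 (inv_into UNIV j x))) ` carrier (transport_mod j (P 1))"
      using res_exact_0[OF res] mod_hom_closed[OF res_d_hom[OF res]] j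
      by (auto simp: a_kernel_def' carrier zero image_image inj_eq)
  qed (rule res_target[OF res])
qed

section \<open>Weak injective dimension in terms of finitely generated resolutions\<close>

lemma hom_group_carrier:
  "f \<in> carrier (hom_group R N M) \<longleftrightarrow> f \<in> mod_hom R N M \<and> f \<in> extensional (carrier N)"
  by (simp add: hom_group_def)

lemma mod_hom_cong:
  assumes "left_module R N" "f \<in> mod_hom R N M" "\<And>x. x \<in> carrier N \<Longrightarrow> g x = f x"
  shows "g \<in> mod_hom R N M"
proof -
  interpret N: left_module R N by fact
  show ?thesis
    by (rule mod_homI)
      (simp_all add: assms(3) mod_hom_closed[OF assms(2)] mod_hom_add[OF assms(2)] mod_hom_smult[OF assms(2)])
qed

lemma comm_group_hom_group:
  assumes N: "left_module R N" and M: "left_module R M"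
  shows "comm_group (hom_group R N M)"
proof -
  interpret N: left_module R N by fact
  interpret M: left_module R M by fact
  have diff: "(\<lambda>x\<in>carrier N. f x \<ominus>\<^bsub>M\<^esub> g x) \<in> mod_hom R N M"
    if "f \<in> mod_hom R N M" "g \<in> mod_hom R N M" for f g
    by (rule mod_hom_cong[OF N mod_hom_diff[OF N M that]]) simp
  have zero: "(\<lambda>x\<in>carrier N. \<zero>\<^bsub>M\<^esub>) \<in> mod_hom R N M"
    by (rule mod_homI) simp_all
  have neg: "(\<lambda>x\<in>carrier N. \<ominus>\<^bsub>M\<^esub> f x) \<in> mod_hom R N M" if "f \<in> mod_hom R N M" for f
    by (rule mod_hom_cong[OF N diff[OF zero that]]) (use mod_hom_closed[OF that] in \<open>simp add: a_minus_def\<close>)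
  have add: "(\<lambda>x\<in>carrier N. f x \<oplus>\<^bsub>M\<^esub> g x) \<in> mod_hom R N M"
    if "f \<in> mod_hom R N M" "g \<in> mod_hom R N M" for f g
    by (rule mod_hom_cong[OF N diff[OF that(1) neg[OF that(2)]]])
      (use mod_hom_closed[OF that(2)] in \<open>simp add: a_minus_def\<close>)
  show ?thesis
  proof (rule comm_groupI)
    fix f g assume f: "f \<in> carrier (hom_group R N M)" and g: "g \<in> carrier (hom_group R N M)"
    then show "f \<otimes>\<^bsub>hom_group R N M\<^esub> g \<in> carrier (hom_group R N M)"
      using add[of f g] by (simp add: hom_group_def)
    have fg: "f x \<in> carrier M" "g x \<in> carrier M" if "x \<in> carrier N" for x
      using f g that mod_hom_closed by (auto simp: hom_group_def)
    show "f \<otimes>\<^bsub>hom_group R N M\<^esub> g = g \<otimes>\<^bsub>hom_group R N M\<^esub> f"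
      by (auto simp: hom_group_def fg M.M.a_comm)
    fix h assume "h \<in> carrier (hom_group R N M)"
    then have h: "h x \<in> carrier M" if "x \<in> carrier N" for x
      using that mod_hom_closed by (auto simp: hom_group_def)
    show "f \<otimes>\<^bsub>hom_group R N M\<^esub> g \<otimes>\<^bsub>hom_group R N M\<^esub> h = f \<otimes>\<^bsub>hom_group R N M\<^esub> (g \<otimes>\<^bsub>hom_group R N M\<^esub> h)"
      by (auto simp: hom_group_def fg h M.M.a_assoc)
  next
    show "\<one>\<^bsub>hom_group R N M\<^esub> \<in> carrier (hom_group R N M)"
      using zero by (simp add: hom_group_def)
  next
    fix f assume f: "f \<in> carrier (hom_group R N M)"
    then have fx: "f x \<in> carrier M" if "x \<in> carrier N" for x
      using that mod_hom_closed by (auto simp: hom_group_def)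
    show "\<one>\<^bsub>hom_group R N M\<^esub> \<otimes>\<^bsub>hom_group R N M\<^esub> f = f"
      using f by (auto simp: hom_group_def fx extensional_def fun_eq_iff)
    show "\<exists>g\<in>carrier (hom_group R N M). g \<otimes>\<^bsub>hom_group R N M\<^esub> f = \<one>\<^bsub>hom_group R N M\<^esub>"
      by (rule bexI[of _ "\<lambda>x\<in>carrier N. \<ominus>\<^bsub>M\<^esub> f x"])
        (use f neg[of f] in \<open>auto simp: hom_group_def fx M.M.l_neg\<close>)
  qed
qed

lemma hom_diff_hom:
  assumes N: "left_module R (P i)" and N': "left_module R (P (Suc i))"
    and d: "d i \<in> mod_hom R (P (Suc i)) (P i)"
  shows "hom_diff P d i \<in> hom (hom_group R (P i) M) (hom_group R (P (Suc i)) M)"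
proof (rule homI)
  fix f assume f: "f \<in> carrier (hom_group R (P i) M)"
  then have "hom_diff P d i f \<in> mod_hom R (P (Suc i)) M"
    by (intro mod_hom_cong[OF N' mod_hom_comp[OF d]]) (auto simp: hom_group_def hom_diff_def compose_def)
  then show "hom_diff P d i f \<in> carrier (hom_group R (P (Suc i)) M)"
    by (auto simp: hom_group_def hom_diff_def)
  fix g assume g: "g \<in> carrier (hom_group R (P i) M)"
  show "hom_diff P d i (f \<otimes>\<^bsub>hom_group R (P i) M\<^esub> g) =
      hom_diff P d i f \<otimes>\<^bsub>hom_group R (P (Suc i)) M\<^esub> hom_diff P d i g"
    by (auto simp: hom_group_def hom_diff_def compose_def mod_hom_closed[OF d])
qed

lemma (in comm_group) trivial_FactGroup_iff:
  assumes K: "subgroup K G" and B: "subgroup B G" and sub: "B \<subseteq> K"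
  shows "trivial_group ((G\<lparr>carrier := K\<rparr>) Mod B) \<longleftrightarrow> B = K"
proof -
  let ?K = "G\<lparr>carrier := K\<rparr>"
  interpret K: comm_group ?K
    by (rule group.group_comm_groupI[OF subgroup_imp_group[OF K]])
      (use subgroup.subset[OF K] in \<open>auto simp: subset_iff m_comm\<close>)
  have BK: "subgroup B ?K" by (rule subgroup_incl[OF B K sub])
  then have "B \<lhd> ?K" using K.normal_iff_subgroup by blast
  then have grp: "group (?K Mod B)" by (rule normal.factorgroup_is_group)
  show ?thesis
  proof
    assume "trivial_group (?K Mod B)"
    then have cosets: "rcosets\<^bsub>?K\<^esub> B = {B}" by (simp add: trivial_group_def FactGroup_def)
    have "a \<in> B" if "a \<in> K" for a
    proof -
      have "B #>\<^bsub>?K\<^esub> a \<in> rcosets\<^bsub>?K\<^esub> B" using that by (auto simp: RCOSETS_def)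
      then have "B #>\<^bsub>?K\<^esub> a = B" using cosets by simp
      then show "a \<in> B" using K.coset_join1[OF _ _ BK, of a] that sub by simp
    qed
    with sub show "B = K" by blast
  next
    assume eq: "B = K"
    have "B #>\<^bsub>?K\<^esub> a = B" if "a \<in> K" for a
      using K.coset_join2[OF _ BK, of a] that eq by simp
    then have "rcosets\<^bsub>?K\<^esub> B = {B}"
      using BK subgroup.one_closed[OF B] eq unfolding RCOSETS_def by auto
    then show "trivial_group (?K Mod B)"
      using grp by (simp add: trivial_group_def FactGroup_def)
  qed
qed

text \<open>Both sides say that all cocycles are coboundaries. Cocycles and coboundaries are extensional
  functions on the left, while \<open>ext_vanishes\<close> admits any function that is a homomorphism on the
  carrier; restriction passes from one to the other.\<close>

lemma hom_cohomology_trivial_iff: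
  assumes res: "projective_resolution R P d e F" and M: "left_module R M"
  shows "trivial_group (hom_cohomology R P d M (Suc i)) \<longleftrightarrow> ext_vanishes R P d M i"
proof -
  note lm = res_left_module[OF res] and d = res_d_hom[OF res]
  let ?G = "\<lambda>i. hom_group R (P i) M"
  let ?K = "kernel (?G (Suc i)) (?G (Suc (Suc i))) (hom_diff P d (Suc i))"
  let ?B = "hom_diff P d i ` carrier (?G i)"
  have G: "comm_group (?G i)" for i by (rule comm_group_hom_group[OF lm M])
  have hom: "group_hom (?G i) (?G (Suc i)) (hom_diff P d i)" for i
    by (intro group_hom.intro group_hom_axioms.intro comm_group.axioms(2)[OF G] hom_diff_hom lm d)
  have K: "subgroup ?K (?G (Suc i))" by (rule group_hom.subgroup_kernel[OF hom])
  have B: "subgroup ?B (?G (Suc i))" by (rule group_hom.img_is_subgroup[OF hom])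
  have memK: "f \<in> ?K \<longleftrightarrow> f \<in> carrier (?G (Suc i)) \<and>
      (\<forall>x\<in>carrier (P (Suc (Suc i))). f (d (Suc i) x) = \<zero>\<^bsub>M\<^esub>)" for f
    by (auto simp: kernel_def hom_diff_def hom_group_def compose_def fun_eq_iff restrict_def split: if_splits)
  have memB: "f \<in> ?B \<longleftrightarrow> f \<in> carrier (?G (Suc i)) \<and>
      (\<exists>g\<in>mod_hom R (P i) M. \<forall>x\<in>carrier (P (Suc i)). f x = g (d i x))" for f
  proof
    assume "f \<in> ?B"
    then obtain g where g: "g \<in> carrier (?G i)" "f = hom_diff P d i g" by blast
    have "f \<in> carrier (?G (Suc i))"
      using subgroup.subset[OF B] \<open>f \<in> ?B\<close> by (rule subsetD)
    moreover have "g \<in> mod_hom R (P i) M" "\<forall>x\<in>carrier (P (Suc i)). f x = g (d i x)"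
      using g by (simp_all add: hom_group_carrier hom_diff_def compose_def)
    ultimately show "f \<in> carrier (?G (Suc i)) \<and>
      (\<exists>g\<in>mod_hom R (P i) M. \<forall>x\<in>carrier (P (Suc i)). f x = g (d i x))" by (intro conjI bexI[of _ g])
  next
    assume f: "f \<in> carrier (?G (Suc i)) \<and>
      (\<exists>g\<in>mod_hom R (P i) M. \<forall>x\<in>carrier (P (Suc i)). f x = g (d i x))"
    then obtain g where g: "g \<in> mod_hom R (P i) M" and eq: "\<forall>x\<in>carrier (P (Suc i)). f x = g (d i x)"
      by (elim conjE bexE)
    show "f \<in> ?B"
    proof (rule image_eqI)
      show "restrict g (carrier (P i)) \<in> carrier (?G i)"
        using mod_hom_cong[OF lm g, of "restrict g (carrier (P i))"] by (simp add: hom_group_carrier)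
      have "f \<in> extensional (carrier (P (Suc i)))"
        using f by (simp add: hom_group_carrier)
      then show "f = hom_diff P d i (restrict g (carrier (P i)))"
        by (intro extensionalityI[of _ "carrier (P (Suc i))"])
          (simp_all add: hom_diff_def compose_def eq mod_hom_closed[OF d])
    qed
  qed
  have sub: "?B \<subseteq> ?K"
  proof
    fix f assume fB: "f \<in> ?B"
    then obtain g where g: "g \<in> mod_hom R (P i) M" and eq: "\<forall>x\<in>carrier (P (Suc i)). f x = g (d i x)"
      unfolding memB by (elim conjE bexE)
    have "f (d (Suc i) x) = \<zero>\<^bsub>M\<^esub>" if x: "x \<in> carrier (P (Suc (Suc i)))" for x
      using eq mod_hom_closed[OF d x] res_d_d[OF res x] mod_hom_zero[OF lm M g] by simp
    then show "f \<in> ?K" using fB unfolding memK memB by blast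
  qed
  have "trivial_group (hom_cohomology R P d M (Suc i)) \<longleftrightarrow> ?B = ?K"
    unfolding hom_cohomology_def cocycles_def coboundaries_def nat.case
    by (rule comm_group.trivial_FactGroup_iff[OF G K B sub])
  also have "\<dots> \<longleftrightarrow> ext_vanishes R P d M i"
  proof
    assume eq: "?B = ?K"
    show "ext_vanishes R P d M i"
    proof (rule ext_vanishesI)
      fix f assume f: "f \<in> mod_hom R (P (Suc i)) M"
        and z: "\<And>x. x \<in> carrier (P (Suc (Suc i))) \<Longrightarrow> f (d (Suc i) x) = \<zero>\<^bsub>M\<^esub>"
      let ?f = "restrict f (carrier (P (Suc i)))"
      have "?f \<in> ?K"
        unfolding memK
        using mod_hom_cong[OF lm f, of ?f] z mod_hom_closed[OF d] by (simp add: hom_group_carrier)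
      then have "\<exists>g\<in>mod_hom R (P i) M. \<forall>x\<in>carrier (P (Suc i)). ?f x = g (d i x)"
        unfolding eq[symmetric] memB by (rule conjunct2)
      then show "\<exists>g\<in>mod_hom R (P i) M. \<forall>x\<in>carrier (P (Suc i)). f x = g (d i x)"
        by simp
    qed
  next
    assume v: "ext_vanishes R P d M i"
    have "?K \<subseteq> ?B"
    proof
      fix f assume "f \<in> ?K"
      then have f: "f \<in> carrier (?G (Suc i))" "f \<in> mod_hom R (P (Suc i)) M"
        and z: "\<forall>x\<in>carrier (P (Suc (Suc i))). f (d (Suc i) x) = \<zero>\<^bsub>M\<^esub>"
        unfolding memK hom_group_carrier by blast+
      show "f \<in> ?B"
        unfolding memB using v f z unfolding ext_vanishes_def by blast
    qed
    with sub show "?B = ?K" by blast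
  qed
  finally show ?thesis .
qed

text \<open>By comparison of resolutions, the choice made in \<open>Ext\<close> does not matter once it is known to be a
  choice of an actual resolution, that is, once some resolution exists on the type in question.\<close>

lemma Ext_trivial_iff:
  fixes R :: "'r ring" and P :: "nat \<Rightarrow> ('r, 'r list) module" and F :: "('r, 'r list) module"
  assumes res: "projective_resolution R P d e F" and M: "left_module R M"
  shows "trivial_group (Ext R (i + 1) F M) \<longleftrightarrow> ext_vanishes R P d M i"
proof -
  have "inj (\<lambda>x :: 'r list. [Inr x :: 'r + 'r list])" by (rule injI) simp
  from projective_resolution_transport[OF res this]
  have "\<exists>t. case t of (P :: nat \<Rightarrow> ('r, ('r + 'r list) list) module, d, e) \<Rightarrow> projective_resolution R P d e F"
    by blast
  then have some: "case (SOME (P :: nat \<Rightarrow> ('r, ('r + 'r list) list) module, d, e). projective_resolution R P d e F)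
      of (P, d, e) \<Rightarrow> projective_resolution R P d e F"
    by (rule someI_ex)
  obtain Q d' e' where Q: "(SOME (P :: nat \<Rightarrow> ('r, ('r + 'r list) list) module, d, e).
      projective_resolution R P d e F) = (Q, d', e')"
    by (rule prod_cases3)
  have res': "projective_resolution R Q d' e' F"
    using some unfolding Q by simp
  have "trivial_group (Ext R (i + 1) F M) \<longleftrightarrow> ext_vanishes R Q d' M i"
    unfolding Ext_def Q by (simp add: hom_cohomology_trivial_iff[OF res' M])
  also have "\<dots> \<longleftrightarrow> ext_vanishes R P d M i"
    using ext_vanishes_indep[OF res res' M] ext_vanishes_indep[OF res' res M] by blast
  finally show ?thesis .
qed

text \<open>Cutting off a resolution of \<open>F\<close> resolves the first syzygy of \<open>F\<close>. In particular syzygies of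
  super finitely presented modules are super finitely presented, and the vanishing of \<open>Ext\<^sup>m\<^sup>+\<^sup>1\<close> on
  all of them propagates to \<open>Ext\<^sup>m\<^sup>+\<^sup>2\<close>.\<close>

lemma projective_resolution_syzygy:
  assumes res: "projective_resolution R P d e F"
  shows "projective_resolution R (\<lambda>i. P (Suc i)) (\<lambda>i. d (Suc i)) (d 0)
    ((P 0)\<lparr>carrier := d 0 ` carrier (P (Suc 0))\<rparr>)"
proof -
  note d = res_d_hom[OF res] and lm = res_left_module[OF res]
  let ?K = "(P 0)\<lparr>carrier := d 0 ` carrier (P (Suc 0))\<rparr>"
  interpret P0: left_module R "P 0" by (rule lm)
  interpret P1: left_module R "P (Suc 0)" by (rule lm)
  have "left_module R ?K"
  proof (rule P0.left_module_submodule)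
    show "\<zero>\<^bsub>P 0\<^esub> \<in> d 0 ` carrier (P (Suc 0))"
      by (rule image_eqI[of _ _ "\<zero>\<^bsub>P (Suc 0)\<^esub>"]) (simp_all add: mod_hom_zero[OF lm lm d])
    fix x y assume "x \<in> d 0 ` carrier (P (Suc 0))" "y \<in> d 0 ` carrier (P (Suc 0))"
    then show "x \<oplus>\<^bsub>P 0\<^esub> y \<in> d 0 ` carrier (P (Suc 0))"
      by (auto simp: mod_hom_add[OF d, symmetric])
  next
    fix a x assume "a \<in> carrier R" "x \<in> d 0 ` carrier (P (Suc 0))"
    then show "a \<odot>\<^bsub>P 0\<^esub> x \<in> d 0 ` carrier (P (Suc 0))"
      by (auto simp: mod_hom_smult[OF d, symmetric])
  qed (use mod_hom_closed[OF d] in auto)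
  moreover have "d 0 \<in> mod_hom R (P (Suc 0)) ?K"
    by (rule mod_homI) (simp_all add: mod_hom_add[OF d] mod_hom_smult[OF d])
  moreover have "a_kernel (P (Suc 0)) ?K (d 0) = d (Suc 0) ` carrier (P (Suc 1))"
    using res by (simp add: projective_resolution_def a_kernel_def')
  ultimately show ?thesis
    using res unfolding projective_resolution_def by (intro conjI allI) simp_all
qed

text \<open>If \<open>Ext\<^sup>m\<^sup>+\<^sup>1\<close> vanishes on all super finitely presented modules for some \<open>m \<le> n\<close>, then passing to
  syzygies shows the same for \<open>Ext\<^sup>n\<^sup>+\<^sup>1\<close>. Hence one degree, the same for all modules of dimension at most
  \<open>n\<close>, decides; this is what makes products of such modules tractable. Moreover the condition may be
  tested on finitely generated resolutions, as the argument for pure submodules requires.\<close>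

lemma wid_le_iff:
  fixes R :: "'r ring"
  assumes M: "left_module R M"
  shows "wid R M \<le> enat n \<longleftrightarrow>
    (\<forall>(P :: nat \<Rightarrow> ('r, 'r list) module) d e (F :: ('r, 'r list) module).
       projective_resolution R P d e F \<longrightarrow> (\<forall>i. fin_gen R (P i)) \<longrightarrow> ext_vanishes R P d M n)"
proof -
  define V where "V m \<longleftrightarrow> (\<forall>(P :: nat \<Rightarrow> ('r, 'r list) module) d e (F :: ('r, 'r list) module).
       projective_resolution R P d e F \<longrightarrow> (\<forall>i. fin_gen R (P i)) \<longrightarrow> ext_vanishes R P d M m)" for m
  have V: "(\<forall>F :: ('r, 'r list) module. super_fin_pres R F \<longrightarrow> trivial_group (Ext R (m + 1) F M)) \<longleftrightarrow> V m" for m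
    unfolding V_def super_fin_pres_def using Ext_trivial_iff[OF _ M] by metis
  have step: "V (Suc m)" if "V m" for m
    unfolding V_def
  proof (intro allI impI)
    fix P :: "nat \<Rightarrow> ('r, 'r list) module" and d e and F :: "('r, 'r list) module"
    assume res: "projective_resolution R P d e F" and fg: "\<forall>i. fin_gen R (P i)"
    from that projective_resolution_syzygy[OF res] fg
    have "ext_vanishes R (\<lambda>i. P (Suc i)) (\<lambda>i. d (Suc i)) M m"
      unfolding V_def by blast
    then show "ext_vanishes R P d M (Suc m)"
      by (simp add: ext_vanishes_def)
  qed
  have mono: "V n" if "V m" "m \<le> n" for m
    using that(2,1) by (induction rule: dec_induct) (auto intro: step)
  have "wid R M \<le> enat n \<longleftrightarrow> (\<exists>m\<le>n. V m)"
  proof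
    assume le: "wid R M \<le> enat n"
    have wid: "wid R M = Inf (enat ` {m. V m})" by (simp add: wid_def V[symmetric])
    then have ne: "enat ` {m. V m} \<noteq> {}" using le by (metis Inf_empty top_enat_def enat_ord_simps(5) infinity_ileE)
    then have "wid R M \<in> enat ` {m. V m}"
      unfolding wid Inf_enat_def by (auto intro: LeastI)
    then show "\<exists>m\<le>n. V m" using le by auto
  next
    assume "\<exists>m\<le>n. V m"
    then obtain m where m: "m \<le> n" "V m" by blast
    have "wid R M \<le> enat m"
      unfolding wid_def V using m(2) by (intro Inf_lower) simp
    also have "enat m \<le> enat n" using m by simp
    finally show "wid R M \<le> enat n" .
  qed
  also have "\<dots> \<longleftrightarrow> V n" using mono by blast
  finally show ?thesis unfolding V_def .
qed

section \<open>Products\<close>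

definition prod_mod :: "'i set \<Rightarrow> ('i \<Rightarrow> ('r, 'u) module) \<Rightarrow> ('r, 'i \<Rightarrow> 'u) module" where
  "prod_mod I N =
    \<lparr>carrier = (\<Pi>\<^sub>E i\<in>I. carrier (N i)), monoid.mult = undefined, one = undefined,
     ring.zero = (\<lambda>i\<in>I. \<zero>\<^bsub>N i\<^esub>),
     add = (\<lambda>x y. \<lambda>i\<in>I. x i \<oplus>\<^bsub>N i\<^esub> y i),
     smult = (\<lambda>a x. \<lambda>i\<in>I. a \<odot>\<^bsub>N i\<^esub> x i)\<rparr>"

lemma left_module_prod_mod:
  assumes R: "ring R" and N: "\<And>i. i \<in> I \<Longrightarrow> left_module R (N i)"
  shows "left_module R (prod_mod I N)"
proof -
  note ag = left_module.axioms(2)[OF N]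
  let ?P = "prod_mod I N"
  have cl: "x i \<in> carrier (N i)" if "x \<in> carrier ?P" "i \<in> I" for x i
    using that by (auto simp: prod_mod_def)
  have eqI: "x = y" if "x \<in> carrier ?P" "y \<in> carrier ?P" "\<And>i. i \<in> I \<Longrightarrow> x i = y i" for x y
    using that by (auto simp: prod_mod_def intro: PiE_ext)
  have add: "x \<oplus>\<^bsub>?P\<^esub> y \<in> carrier ?P" if "x \<in> carrier ?P" "y \<in> carrier ?P" for x y
    using that abelian_groupE(1)[OF ag] by (auto simp: prod_mod_def PiE_iff)
  have smult: "a \<odot>\<^bsub>?P\<^esub> x \<in> carrier ?P" if "a \<in> carrier R" "x \<in> carrier ?P" for a x
    using that left_module.smult_closed[OF N] by (auto simp: prod_mod_def PiE_iff)
  have zero: "\<zero>\<^bsub>?P\<^esub> \<in> carrier ?P"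
    using abelian_groupE(2)[OF ag] by (auto simp: prod_mod_def)
  have at: "(x \<oplus>\<^bsub>?P\<^esub> y) i = x i \<oplus>\<^bsub>N i\<^esub> y i" "(a \<odot>\<^bsub>?P\<^esub> x) i = a \<odot>\<^bsub>N i\<^esub> x i"
    "\<zero>\<^bsub>?P\<^esub> i = \<zero>\<^bsub>N i\<^esub>" if "i \<in> I" for x y a i
    using that by (simp_all add: prod_mod_def)
  have neg: "\<exists>y\<in>carrier ?P. y \<oplus>\<^bsub>?P\<^esub> x = \<zero>\<^bsub>?P\<^esub>" if x: "x \<in> carrier ?P" for x
  proof (rule bexI)
    let ?y = "(\<ominus>\<^bsub>R\<^esub> \<one>\<^bsub>R\<^esub>) \<odot>\<^bsub>?P\<^esub> x"
    show y: "?y \<in> carrier ?P"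
      using R by (intro smult x) (simp add: ring.ring_simprules)
    show "?y \<oplus>\<^bsub>?P\<^esub> x = \<zero>\<^bsub>?P\<^esub>"
    proof (rule eqI[OF add[OF y x] zero])
      fix i assume i: "i \<in> I"
      interpret N: left_module R "N i" by (rule N[OF i])
      show "(?y \<oplus>\<^bsub>?P\<^esub> x) i = \<zero>\<^bsub>?P\<^esub> i"
        using cl[OF x i] by (simp add: at[OF i] N.smult_minus_one N.M.l_neg)
    qed
  qed
  show ?thesis
  proof (rule left_moduleI[OF R add zero _ _ _ neg smult])
    fix x y z assume x: "x \<in> carrier ?P" and y: "y \<in> carrier ?P" and z: "z \<in> carrier ?P"
    show "x \<oplus>\<^bsub>?P\<^esub> y \<oplus>\<^bsub>?P\<^esub> z = x \<oplus>\<^bsub>?P\<^esub> (y \<oplus>\<^bsub>?P\<^esub> z)"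
    proof (rule eqI)
      fix i assume i: "i \<in> I"
      show "(x \<oplus>\<^bsub>?P\<^esub> y \<oplus>\<^bsub>?P\<^esub> z) i = (x \<oplus>\<^bsub>?P\<^esub> (y \<oplus>\<^bsub>?P\<^esub> z)) i"
        unfolding at[OF i] by (rule abelian_groupE(3)[OF ag[OF i] cl[OF x i] cl[OF y i] cl[OF z i]])
    qed (intro add x y z)+
  next
    fix x y assume x: "x \<in> carrier ?P" and y: "y \<in> carrier ?P"
    show "x \<oplus>\<^bsub>?P\<^esub> y = y \<oplus>\<^bsub>?P\<^esub> x"
    proof (rule eqI)
      fix i assume i: "i \<in> I"
      show "(x \<oplus>\<^bsub>?P\<^esub> y) i = (y \<oplus>\<^bsub>?P\<^esub> x) i"
        unfolding at[OF i] by (rule abelian_groupE(4)[OF ag[OF i] cl[OF x i] cl[OF y i]])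
    qed (intro add x y)+
  next
    fix x assume x: "x \<in> carrier ?P"
    show "\<zero>\<^bsub>?P\<^esub> \<oplus>\<^bsub>?P\<^esub> x = x"
    proof (rule eqI)
      fix i assume i: "i \<in> I"
      show "(\<zero>\<^bsub>?P\<^esub> \<oplus>\<^bsub>?P\<^esub> x) i = x i"
        unfolding at[OF i] by (rule abelian_groupE(5)[OF ag[OF i] cl[OF x i]])
    qed (intro add zero x)+
    show "\<one>\<^bsub>R\<^esub> \<odot>\<^bsub>?P\<^esub> x = x"
    proof (rule eqI)
      fix i assume i: "i \<in> I"
      show "(\<one>\<^bsub>R\<^esub> \<odot>\<^bsub>?P\<^esub> x) i = x i"
        unfolding at[OF i] by (rule left_module.smult_one[OF N[OF i] cl[OF x i]])
    qed (use R x in \<open>auto intro!: smult simp: ring.ring_simprules\<close>)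
  next
    fix a b x assume a: "a \<in> carrier R" and b: "b \<in> carrier R" and x: "x \<in> carrier ?P"
    show "(a \<oplus>\<^bsub>R\<^esub> b) \<odot>\<^bsub>?P\<^esub> x = a \<odot>\<^bsub>?P\<^esub> x \<oplus>\<^bsub>?P\<^esub> b \<odot>\<^bsub>?P\<^esub> x"
    proof (rule eqI)
      fix i assume i: "i \<in> I"
      show "((a \<oplus>\<^bsub>R\<^esub> b) \<odot>\<^bsub>?P\<^esub> x) i = (a \<odot>\<^bsub>?P\<^esub> x \<oplus>\<^bsub>?P\<^esub> b \<odot>\<^bsub>?P\<^esub> x) i"
        unfolding at[OF i] by (rule left_module.smult_l_distr[OF N[OF i] a b cl[OF x i]])
    qed (use R a b x in \<open>auto intro!: smult add simp: ring.ring_simprules\<close>)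
    show "(a \<otimes>\<^bsub>R\<^esub> b) \<odot>\<^bsub>?P\<^esub> x = a \<odot>\<^bsub>?P\<^esub> (b \<odot>\<^bsub>?P\<^esub> x)"
    proof (rule eqI)
      fix i assume i: "i \<in> I"
      show "((a \<otimes>\<^bsub>R\<^esub> b) \<odot>\<^bsub>?P\<^esub> x) i = (a \<odot>\<^bsub>?P\<^esub> (b \<odot>\<^bsub>?P\<^esub> x)) i"
        unfolding at[OF i] by (rule left_module.smult_assoc1[OF N[OF i] a b cl[OF x i]])
    qed (use R a b x in \<open>auto intro!: smult simp: ring.ring_simprules\<close>)
  next
    fix a x y assume a: "a \<in> carrier R" and x: "x \<in> carrier ?P" and y: "y \<in> carrier ?P"
    show "a \<odot>\<^bsub>?P\<^esub> (x \<oplus>\<^bsub>?P\<^esub> y) = a \<odot>\<^bsub>?P\<^esub> x \<oplus>\<^bsub>?P\<^esub> a \<odot>\<^bsub>?P\<^esub> y"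
    proof (rule eqI)
      fix i assume i: "i \<in> I"
      show "(a \<odot>\<^bsub>?P\<^esub> (x \<oplus>\<^bsub>?P\<^esub> y)) i = (a \<odot>\<^bsub>?P\<^esub> x \<oplus>\<^bsub>?P\<^esub> a \<odot>\<^bsub>?P\<^esub> y) i"
        unfolding at[OF i] by (rule left_module.smult_r_distr[OF N[OF i] a cl[OF x i] cl[OF y i]])
    qed (use a x y in \<open>auto intro!: smult add\<close>)
  qed
qed

lemma prod_mod_proj_hom:
  "i \<in> I \<Longrightarrow> (\<lambda>x. x i) \<in> mod_hom R (prod_mod I N) (N i)"
  by (rule mod_homI) (auto simp: prod_mod_def)

lemma prod_mod_tuple_hom:
  assumes "left_module R A" "\<And>i. i \<in> I \<Longrightarrow> f i \<in> mod_hom R A (N i)"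
  shows "(\<lambda>x. \<lambda>i\<in>I. f i x) \<in> mod_hom R A (prod_mod I N)"
proof -
  interpret A: left_module R A by fact
  show ?thesis
    by (rule mod_homI)
      (auto simp: prod_mod_def mod_hom_closed[OF assms(2)] mod_hom_add[OF assms(2)] mod_hom_smult[OF assms(2)]
        intro!: restrict_ext)
qed

text \<open>A map into a product is a cocycle, or a coboundary, if and only if all its components are.\<close>

lemma ext_vanishes_prod_mod:
  assumes res: "projective_resolution R P d e F"
    and v: "\<And>i. i \<in> I \<Longrightarrow> ext_vanishes R P d (N i) n"
  shows "ext_vanishes R P d (prod_mod I N) n"
proof (rule ext_vanishesI)
  fix f assume f: "f \<in> mod_hom R (P (Suc n)) (prod_mod I N)"
    and z: "\<And>x. x \<in> carrier (P (Suc (Suc n))) \<Longrightarrow> f (d (Suc n) x) = \<zero>\<^bsub>prod_mod I N\<^esub>"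
  have "\<exists>g. g \<in> mod_hom R (P n) (N i) \<and> (\<forall>x\<in>carrier (P (Suc n)). f x i = g (d n x))" if i: "i \<in> I" for i
  proof -
    have "f (d (Suc n) x) i = \<zero>\<^bsub>N i\<^esub>" if "x \<in> carrier (P (Suc (Suc n)))" for x
      using z[OF that] i by (simp add: prod_mod_def)
    then show ?thesis
      using ext_vanishesD[OF v[OF i] mod_hom_comp[OF f prod_mod_proj_hom[OF i]]] by metis
  qed
  then obtain g where g: "\<And>i. i \<in> I \<Longrightarrow> g i \<in> mod_hom R (P n) (N i)"
    and fg: "\<And>i x. i \<in> I \<Longrightarrow> x \<in> carrier (P (Suc n)) \<Longrightarrow> f x i = g i (d n x)"
    by metis
  show "\<exists>g\<in>mod_hom R (P n) (prod_mod I N). \<forall>x\<in>carrier (P (Suc n)). f x = g (d n x)"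
  proof (intro bexI[of _ "\<lambda>y. \<lambda>i\<in>I. g i y"] ballI)
    fix x assume x: "x \<in> carrier (P (Suc n))"
    have "f x \<in> extensional I"
      using mod_hom_closed[OF f x] by (simp add: prod_mod_def PiE_iff)
    then show "f x = (\<lambda>i\<in>I. g i (d n x))"
      by (rule extensionalityI[of _ I]) (simp_all add: fg x)
  qed (rule prod_mod_tuple_hom[OF res_left_module[OF res] g])
qed

section \<open>Pure submodules\<close>

definition row_value :: "('r, 'm) module \<Rightarrow> 'r list \<Rightarrow> (nat \<Rightarrow> 'm) \<Rightarrow> 'm" where
  "row_value A r c = (\<Oplus>\<^bsub>A\<^esub>j\<in>{..<length r}. r ! j \<odot>\<^bsub>A\<^esub> c j)"

text \<open>Purity in the form of equations: a finite system of linear equations with right-hand sides in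
  \<open>D\<close> that is solvable in \<open>A\<close> is solvable in \<open>D\<close>. The right-hand sides are not named, since a solution
  \<open>c\<close> in \<open>A\<close> determines them. Solutions are infinite sequences of which a row sees only as many
  entries as it has coefficients, so that no lengths need to be matched.\<close>

definition pure_in :: "'r ring \<Rightarrow> 'm set \<Rightarrow> ('r, 'm) module \<Rightarrow> bool" where
  "pure_in R D A \<longleftrightarrow>
    (\<forall>rows c. (\<forall>r\<in>set rows. set r \<subseteq> carrier R) \<longrightarrow> range c \<subseteq> carrier A \<longrightarrow>
      (\<forall>r\<in>set rows. row_value A r c \<in> D) \<longrightarrow>
      (\<exists>c'. range c' \<subseteq> D \<and> (\<forall>r\<in>set rows. row_value A r c' = row_value A r c)))"

lemma pure_in_carrier: "pure_in R (carrier A) A"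
  unfolding pure_in_def by blast

text \<open>A combination supported in a finite set \<open>T\<close>, enumerated by \<open>t\<close>, is the value of a row of
  coefficients. This is how values of a homomorphism on a projective module become linear equations.\<close>

lemma row_value_eq_lincomb:
  fixes R :: "'r ring"
  assumes A: "left_module R A" and k: "k \<in> carrier (free_mod R E)"
    and t: "bij_betw t {..<m} T" and T: "T \<subseteq> E" "{x. k x \<noteq> \<zero>\<^bsub>R\<^esub>} \<subseteq> T"
    and c: "\<And>x. x \<in> T \<Longrightarrow> c x \<in> carrier A" "\<And>j. j < m \<Longrightarrow> b j = c (t j)"
  shows "row_value A (map (\<lambda>j. k (t j)) [0..<m]) b = lincomb R A c k"
proof -
  interpret A: left_module R A by fact
  have im: "t ` {..<m} = T" and inj: "inj_on t {..<m}" using t by (auto simp: bij_betw_def)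
  have kR: "k x \<in> carrier R" if "x \<in> T" for x
    using k T that by (auto simp: free_mod_def)
  have kc: "k x \<odot>\<^bsub>A\<^esub> c x \<in> carrier A" if "x \<in> T" for x
    by (rule A.smult_closed[OF kR[OF that] c(1)[OF that]])
  have "row_value A (map (\<lambda>j. k (t j)) [0..<m]) b = finsum A (\<lambda>j. k (t j) \<odot>\<^bsub>A\<^esub> c (t j)) {..<m}"
    unfolding row_value_def
    by (rule A.M.finsum_cong') (use kc im c(2) in auto)
  also have "\<dots> = finsum A (\<lambda>x. k x \<odot>\<^bsub>A\<^esub> c x) (t ` {..<m})"
    by (rule A.M.finsum_reindex[OF _ inj, symmetric]) (use kc im in auto)
  also have "\<dots> = lincomb R A c k"
    unfolding im
    by (rule lincomb_eq_finsum[OF A _ T(2) c(1) kR, symmetric]) (use im in auto)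
  finally show ?thesis .
qed

text \<open>For the section \<open>s\<close> of a projective module, this exhibits the module, when finitely generated, as a
  summand of a free module of finite rank. The elements whose coordinates vanish outside \<open>T\<close> form a
  submodule, which is everything as soon as \<open>T\<close> contains the supports of the generators.\<close>

lemma finite_common_support:
  fixes R :: "'r ring"
  assumes P: "left_module R P" and fg: "fin_gen R P" and s: "s \<in> mod_hom R P (free_mod R E)"
  obtains T where "finite T" "T \<subseteq> E" "\<And>y. y \<in> carrier P \<Longrightarrow> {x. s y x \<noteq> \<zero>\<^bsub>R\<^esub>} \<subseteq> T"
proof -
  interpret P: left_module R P by fact
  obtain S where S: "S \<subseteq> carrier P" "finite S"
    and gen: "\<And>H. submodule H R P \<Longrightarrow> S \<subseteq> H \<Longrightarrow> H = carrier P"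
    using fg unfolding fin_gen_def by blast
  let ?supp = "\<lambda>y. {x. s y x \<noteq> \<zero>\<^bsub>R\<^esub>}"
  let ?T = "\<Union>(?supp ` S)"
  have fin: "finite (?supp y)" "?supp y \<subseteq> E" if "y \<in> carrier P" for y
    using mod_hom_closed[OF s that] by (auto simp: free_mod_def)
  have F: "left_module R (free_mod R E)" by (rule left_module_free_mod[OF P.R.ring_axioms])
  have sx: "s y x \<in> carrier R" if "y \<in> carrier P" for y x
    using mod_hom_closed[OF s that] by (cases "x \<in> E") (auto simp: free_mod_def)
  have "submodule {y \<in> carrier P. ?supp y \<subseteq> ?T} R P"
  proof (rule P.submoduleI)
    show "\<zero>\<^bsub>P\<^esub> \<in> {y \<in> carrier P. ?supp y \<subseteq> ?T}"
      using mod_hom_zero[OF P F s] by (simp add: free_mod_def)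
    fix x y assume "x \<in> {y \<in> carrier P. ?supp y \<subseteq> ?T}" "y \<in> {y \<in> carrier P. ?supp y \<subseteq> ?T}"
    moreover from this have "?supp (x \<oplus>\<^bsub>P\<^esub> y) \<subseteq> ?supp x \<union> ?supp y"
      using mod_hom_add[OF s] sx by (auto simp: free_mod_def)
    ultimately show "x \<oplus>\<^bsub>P\<^esub> y \<in> {y \<in> carrier P. ?supp y \<subseteq> ?T}" by blast
  next
    fix a y assume "a \<in> carrier R" "y \<in> {y \<in> carrier P. ?supp y \<subseteq> ?T}"
    moreover from this have "?supp (a \<odot>\<^bsub>P\<^esub> y) \<subseteq> ?supp y"
      using mod_hom_smult[OF s] sx by (auto simp: free_mod_def)
    ultimately show "a \<odot>\<^bsub>P\<^esub> y \<in> {y \<in> carrier P. ?supp y \<subseteq> ?T}" by blast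
  qed blast
  then have "{y \<in> carrier P. ?supp y \<subseteq> ?T} = carrier P"
    by (rule gen) (use S in auto)
  then have *: "?supp y \<subseteq> ?T" if "y \<in> carrier P" for y using that by blast
  show ?thesis
    by (rule that[OF _ _ *]) (use S fin in auto)
qed

text \<open>Let \<open>f\<close> be a cocycle with values in the pure submodule \<open>N\<close>. It is \<open>g \<circ> d n\<close> for some \<open>g\<close> with
  values in \<open>A\<close>, and \<open>g\<close> is to be replaced by a map into \<open>N\<close>. As \<open>P n\<close> is a summand of a free module of
  finite rank, a map on \<open>P n\<close> is obtained from finitely many freely chosen values; as \<open>P (n + 1)\<close> is
  finitely generated, composing it with \<open>d n\<close> yields \<open>f\<close> as soon as these values satisfy finitely many
  linear equations with right-hand sides in \<open>N\<close>. The values of \<open>g\<close> satisfy them in \<open>A\<close>; by purity some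
  values in \<open>N\<close> do.\<close>

lemma ext_vanishes_pure:
  fixes R :: "'r ring"
  assumes res: "projective_resolution R P d e F" and fg: "\<And>i. fin_gen R (P i)"
    and N: "left_module R N" and A: "left_module R A"
    and h: "h \<in> mod_hom R N A" and inj: "inj_on h (carrier N)"
    and pure: "pure_in R (h ` carrier N) A"
    and v: "ext_vanishes R P d A n"
  shows "ext_vanishes R P d N n"
proof (rule ext_vanishesI)
  note lm = res_left_module[OF res] and d = res_d_hom[OF res]
  interpret N: left_module R N by fact
  interpret A: left_module R A by fact
  fix f assume f: "f \<in> mod_hom R (P (Suc n)) N"
    and z: "\<And>x. x \<in> carrier (P (Suc (Suc n))) \<Longrightarrow> f (d (Suc n) x) = \<zero>\<^bsub>N\<^esub>"
  have "h (f (d (Suc n) x)) = \<zero>\<^bsub>A\<^esub>" if "x \<in> carrier (P (Suc (Suc n)))" for x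
    using z[OF that] mod_hom_zero[OF N A h] by simp
  then obtain g where g: "g \<in> mod_hom R (P n) A"
    and hf: "\<And>x. x \<in> carrier (P (Suc n)) \<Longrightarrow> h (f x) = g (d n x)"
    using ext_vanishesD[OF v mod_hom_comp[OF f h]] by metis
  obtain s where s: "s \<in> mod_hom R (P n) (free_mod R (carrier (P n)))"
    and sec: "\<And>x. x \<in> carrier (P n) \<Longrightarrow> lincomb R (P n) (\<lambda>x. x) (s x) = x"
    using projective_section[OF res_projective[OF res]] by blast
  obtain T where T: "finite T" "T \<subseteq> carrier (P n)"
    and supp: "\<And>y. y \<in> carrier (P n) \<Longrightarrow> {x. s y x \<noteq> \<zero>\<^bsub>R\<^esub>} \<subseteq> T"
    using finite_common_support[OF lm fg s] by blast
  obtain t where t: "bij_betw t {..<card T} T"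
    using ex_bij_betw_nat_finite[OF T(1)] by (auto simp: atLeast0LessThan)
  obtain Z where Z: "Z \<subseteq> carrier (P (Suc n))" "finite Z"
    and gen: "\<And>H. submodule H R (P (Suc n)) \<Longrightarrow> Z \<subseteq> H \<Longrightarrow> H = carrier (P (Suc n))"
    using fg[of "Suc n"] unfolding fin_gen_def by blast
  obtain zs where zs: "set zs = Z" using finite_list[OF Z(2)] by blast
  define row where "row y = map (\<lambda>j. s y (t j)) [0..<card T]" for y
  have tT: "t j \<in> T" if "j < card T" for j using t that by (auto simp: bij_betw_def)
  have dZ: "d n y \<in> carrier (P n)" if "y \<in> Z" for y using Z that mod_hom_closed[OF d] by auto
  have sR: "s y x \<in> carrier R" if "y \<in> carrier (P n)" "x \<in> T" for y x
    using mod_hom_closed[OF s that(1)] T that(2) by (auto simp: free_mod_def)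
  \<comment> \<open>Each \<open>y \<in> Z\<close> contributes the row of \<open>d n y\<close>: its unknowns are values on \<open>T\<close>, and the equation
    says that the map with these values sends \<open>d n y\<close> to \<open>f y\<close>. The values of \<open>g\<close> solve it.\<close>
  let ?b = "\<lambda>j. if j < card T then g (t j) else \<zero>\<^bsub>A\<^esub>"
  have row_b: "row_value A (row y) ?b = g y" if y: "y \<in> carrier (P n)" for y
  proof -
    note sy = mod_hom_closed[OF s y]
    have "row_value A (row y) ?b = lincomb R A g (s y)"
      unfolding row_def
      by (rule row_value_eq_lincomb[OF A sy t T(2) supp[OF y]]) (use T mod_hom_closed[OF g] in auto)
    also have "\<dots> = g (lincomb R (P n) (\<lambda>x. x) (s y))"
      by (rule mod_hom_lincomb[OF lm A g _ sy, symmetric])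
    finally show ?thesis by (simp add: sec[OF y])
  qed
  have "\<exists>c. range c \<subseteq> h ` carrier N \<and>
      (\<forall>r\<in>set (map (\<lambda>y. row (d n y)) zs). row_value A r c = row_value A r ?b)"
  proof (rule pure[unfolded pure_in_def, rule_format])
    show "set r \<subseteq> carrier R" if "r \<in> set (map (\<lambda>y. row (d n y)) zs)" for r
      using that sR dZ tT by (auto simp: row_def zs)
    show "range ?b \<subseteq> carrier A"
      using mod_hom_closed[OF g] T tT by auto
    show "row_value A r ?b \<in> h ` carrier N" if "r \<in> set (map (\<lambda>y. row (d n y)) zs)" for r
      using that zs Z mod_hom_closed[OF f] by (auto simp: row_b[OF dZ] hf[symmetric])
  qed
  then obtain c where c: "range c \<subseteq> h ` carrier N"
    and sol: "\<And>y. y \<in> Z \<Longrightarrow> row_value A (row (d n y)) c = g (d n y)"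
    by (auto simp: zs row_b[OF dZ])
  define c' where "c' x = inv_into (carrier N) h (c (inv_into {..<card T} t x))" for x
  have c'N: "c' x \<in> carrier N" for x
    unfolding c'_def by (rule inv_into_into) (use c in auto)
  have hc': "c j = h (c' (t j))" if "j < card T" for j
  proof -
    have "inv_into {..<card T} t (t j) = j"
      using t that by (simp add: bij_betw_def)
    moreover have "c j \<in> h ` carrier N" using c by blast
    ultimately show ?thesis
      unfolding c'_def by (simp add: f_inv_into_f)
  qed
  let ?g = "\<lambda>y. lincomb R N c' (s y)"
  have g': "?g \<in> mod_hom R (P n) N"
    by (rule mod_hom_comp[OF s lincomb_mod_hom[OF N]]) (rule c'N)
  have "f y = ?g (d n y)" if y: "y \<in> Z" for y
  proof -
    note sy = mod_hom_closed[OF s dZ[OF y]]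
    have "h (?g (d n y)) = lincomb R A (\<lambda>x. h (c' x)) (s (d n y))"
      by (rule mod_hom_lincomb[OF N A h c'N sy])
    also have "\<dots> = row_value A (row (d n y)) c"
      unfolding row_def
      by (rule row_value_eq_lincomb[OF A sy t T(2) supp[OF dZ[OF y]], symmetric])
        (use mod_hom_closed[OF h c'N] hc' in auto)
    also have "\<dots> = h (f y)"
      using Z y by (auto simp: sol[OF y] hf)
    finally show ?thesis
      using inj_onD[OF inj] mod_hom_closed[OF g' dZ[OF y]] mod_hom_closed[OF f] Z y by auto
  qed
  then have "f y = ?g (d n y)" if "y \<in> carrier (P (Suc n))" for y
    by (intro mod_hom_eq_on_generators[OF lm N f mod_hom_comp[OF d g'] gen Z(1) _ that])
  then show "\<exists>g\<in>mod_hom R (P n) N. \<forall>x\<in>carrier (P (Suc n)). f x = g (d n x)"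
    by (intro bexI[of _ ?g] ballI g')
qed

section \<open>Closure properties of the class\<close>

lemma WI_le_prod_mod:
  fixes R :: "'r ring"
  assumes R: "ring R" and N: "\<And>i. i \<in> I \<Longrightarrow> N i \<in> WI_le R n"
  shows "prod_mod I N \<in> WI_le R n"
proof -
  have lm: "left_module R (N i)" if "i \<in> I" for i using N[OF that] by (simp add: WI_le_def)
  have lp: "left_module R (prod_mod I N)" by (rule left_module_prod_mod[OF R lm])
  have "wid R (prod_mod I N) \<le> enat n"
    unfolding wid_le_iff[OF lp]
  proof (intro allI impI)
    fix P :: "nat \<Rightarrow> ('r, 'r list) module" and d e and F :: "('r, 'r list) module"
    assume res: "projective_resolution R P d e F" and fg: "\<forall>i. fin_gen R (P i)"
    show "ext_vanishes R P d (prod_mod I N) n"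
    proof (rule ext_vanishes_prod_mod[OF res])
      fix i assume i: "i \<in> I"
      then have "wid R (N i) \<le> enat n" using N by (simp add: WI_le_def)
      then show "ext_vanishes R P d (N i) n"
        using res fg unfolding wid_le_iff[OF lm[OF i]] by blast
    qed
  qed
  with lp show ?thesis by (simp add: WI_le_def)
qed

lemma WI_le_pure:
  fixes R :: "'r ring"
  assumes A: "A \<in> WI_le R n" and N: "left_module R N"
    and h: "h \<in> mod_hom R N A" and inj: "inj_on h (carrier N)"
    and pure: "pure_in R (h ` carrier N) A"
  shows "N \<in> WI_le R n"
proof -
  have lA: "left_module R A" and wA: "wid R A \<le> enat n" using A by (auto simp: WI_le_def)
  have "wid R N \<le> enat n"
    unfolding wid_le_iff[OF N]
  proof (intro allI impI)
    fix P :: "nat \<Rightarrow> ('r, 'r list) module" and d e and F :: "('r, 'r list) module"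
    assume res: "projective_resolution R P d e F" and fg: "\<forall>i. fin_gen R (P i)"
    then have v: "ext_vanishes R P d A n"
      using wA unfolding wid_le_iff[OF lA] by blast
    show "ext_vanishes R P d N n"
      by (rule ext_vanishes_pure[OF res _ N lA h inj pure v]) (use fg in blast)
  qed
  with N show ?thesis by (simp add: WI_le_def)
qed

section \<open>Small pure submodules\<close>

text \<open>Terms name the elements of a pure submodule that contains the image of a given map; the
  generators name the elements of that image. \<open>Sol rows j ts\<close> names the \<open>j\<close>-th unknown of a chosen
  solution of the system with coefficients \<open>rows\<close> and right-hand sides \<open>ts\<close>. That there are few terms bounds the size of this
  submodule.\<close>

datatype ('r, 'm) pure_term =
    Gen 'm
  | Add "('r, 'm) pure_term" "('r, 'm) pure_term"
  | Smult 'r "('r, 'm) pure_term"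
  | Sol "'r list list" nat "('r, 'm) pure_term list"

subsection \<open>Terms as words\<close>

text \<open>Every term is written as a word over \<open>'r + 'm\<close>. The two letters that serve as binary digits
  come from different summands, so they differ even when \<open>'r\<close> and \<open>'m\<close> have one element each.\<close>

abbreviation (input) bit0 :: "'r + 'm" where "bit0 \<equiv> Inl undefined"
abbreviation (input) bit1 :: "'r + 'm" where "bit1 \<equiv> Inr undefined"

text \<open>Each word of the list is announced by the digit \<open>0\<close>, and the digit \<open>1\<close> ends the list. A number
  \<open>j\<close> is written as a list of \<open>j\<close> empty words.\<close>

primrec encode_words :: "('r + 'm) list list \<Rightarrow> ('r + 'm) list" where
  "encode_words [] = [bit1]"
| "encode_words (w # ws) = bit0 # w @ encode_words ws"

primrec encode_term :: "('r, 'm) pure_term \<Rightarrow> ('r + 'm) list" where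
  "encode_term (Gen x) = [bit0, bit0, Inr x]"
| "encode_term (Add s t) = [bit0, bit1] @ encode_term s @ encode_term t"
| "encode_term (Smult a t) = [bit1, bit0, Inl a] @ encode_term t"
| "encode_term (Sol rows j ts) = [bit1, bit1] @
    encode_words (map (\<lambda>r. encode_words (map (\<lambda>a. [Inl a]) r)) rows) @
    encode_words (map (\<lambda>_. []) (replicate j ())) @
    encode_words (map encode_term ts)"

text \<open>Injectivity alone would not survive concatenation. The property of being a prefix code, that a
  code word is recognized at the front of any longer word, does.\<close>

lemma encode_words_prefix_code:
  assumes "\<And>x y u v. x \<in> set xs \<Longrightarrow> e x @ u = e y @ v \<Longrightarrow> x = y \<and> u = v"
    and "encode_words (map e xs) @ u = encode_words (map e ys) @ v"
  shows "xs = ys \<and> u = v"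
  using assms
proof (induction xs arbitrary: ys)
  case Nil
  then show ?case by (cases ys) auto
next
  case (Cons x xs)
  then obtain y ys' where ys: "ys = y # ys'" by (cases ys) auto
  have "e x @ (encode_words (map e xs) @ u) = e y @ (encode_words (map e ys') @ v)"
    using Cons.prems(2) ys by simp
  from Cons.prems(1)[OF _ this]
  have hd: "x = y" and tl: "encode_words (map e xs) @ u = encode_words (map e ys') @ v"
    by simp_all
  have "z = y \<and> u = v" if "z \<in> set xs" "e z @ u = e y @ v" for z y u v
    by (rule Cons.prems(1)[OF _ that(2)]) (use that(1) in simp)
  from Cons.IH[OF this tl] hd ys show ?case by simp
qed

lemma encode_term_prefix_code:
  "encode_term s @ u = encode_term t @ v \<Longrightarrow> s = t \<and> u = v"
proof (induction s arbitrary: t u v)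
  case (Gen x)
  then show ?case by (cases t) auto
next
  case (Add s1 s2)
  from Add.prems obtain t1 t2 where t: "t = Add t1 t2" by (cases t) auto
  have "encode_term s1 @ (encode_term s2 @ u) = encode_term t1 @ (encode_term t2 @ v)"
    using Add.prems t by simp
  then have "s1 = t1" "encode_term s2 @ u = encode_term t2 @ v"
    using Add.IH(1) by blast+
  then show ?case using Add.IH(2) t by blast
next
  case (Smult a s)
  from Smult.prems obtain t' where "t = Smult a t'" "encode_term s @ u = encode_term t' @ v"
    by (cases t) auto
  then show ?case using Smult.IH by blast
next
  case (Sol rows j ts)
  from Sol.prems obtain rows' j' ts' where t: "t = Sol rows' j' ts'" by (cases t) auto
  let ?letters = "\<lambda>r. encode_words (map (\<lambda>a. [Inl a]) r)"
  have rows: "rows = rows'" and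
    "encode_words (map (\<lambda>_. []) (replicate j ())) @ encode_words (map encode_term ts) @ u =
      encode_words (map (\<lambda>_. []) (replicate j' ())) @ encode_words (map encode_term ts') @ v"
    using encode_words_prefix_code[where e = ?letters and xs = rows and ys = rows',
        OF encode_words_prefix_code[where e = "\<lambda>a. [Inl a]"]]
      Sol.prems unfolding t by auto
  then have "replicate j () = replicate j' ()" and
    "encode_words (map encode_term ts) @ u = encode_words (map encode_term ts') @ v"
    using encode_words_prefix_code[where e = "\<lambda>_. []" and xs = "replicate j ()" and ys = "replicate j' ()"]
    by auto
  moreover from this have "ts = ts' \<and> u = v"
    using encode_words_prefix_code[where e = encode_term and xs = ts and ys = ts'] Sol.IH by blast
  moreover have "j = j'"
    using arg_cong[OF calculation(1), of length] by simp
  ultimately show ?case using t rows by simp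
qed

lemma inj_encode_term: "inj encode_term"
  by (rule injI) (use encode_term_prefix_code[where u = "[]" and v = "[]"] in auto)

subsection \<open>Values of terms\<close>

definition solves :: "('r, 'm) module \<Rightarrow> 'r list list \<Rightarrow> 'm list \<Rightarrow> (nat \<Rightarrow> 'm) \<Rightarrow> bool" where
  "solves A rows b c \<longleftrightarrow> range c \<subseteq> carrier A \<and> map (\<lambda>r. row_value A r c) rows = b"

text \<open>The default value \<open>\<zero>\<close> keeps the value of every term in the module, also that of terms with a
  generator outside the domain of the map, with a coefficient outside the ring, or with a system that
  has no solution.\<close>

primrec term_value :: "'r ring \<Rightarrow> ('r, 'd) module \<Rightarrow> ('m \<Rightarrow> 'd) \<Rightarrow> ('r, 'm) pure_term \<Rightarrow> 'd" where
  "term_value R A f (Gen x) = (if f x \<in> carrier A then f x else \<zero>\<^bsub>A\<^esub>)"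
| "term_value R A f (Add s t) = term_value R A f s \<oplus>\<^bsub>A\<^esub> term_value R A f t"
| "term_value R A f (Smult a t) = (if a \<in> carrier R then a \<odot>\<^bsub>A\<^esub> term_value R A f t else \<zero>\<^bsub>A\<^esub>)"
| "term_value R A f (Sol rows j ts) =
    (if \<exists>c. solves A rows (map (term_value R A f) ts) c
     then (SOME c. solves A rows (map (term_value R A f) ts) c) j else \<zero>\<^bsub>A\<^esub>)"

lemma term_value_closed:
  assumes "left_module R A"
  shows "term_value R A f t \<in> carrier A"
proof -
  interpret A: left_module R A by fact
  show ?thesis
  proof (induction t)
    case (Sol rows j ts)
    let ?solves = "solves A rows (map (term_value R A f) ts)"
    show ?case
    proof (cases "\<exists>c. ?solves c")
      case True
      define c where "c = (SOME c. ?solves c)"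
      have "?solves c" unfolding c_def using True by (rule someI_ex)
      then have "c j \<in> carrier A" unfolding solves_def by blast
      with True show ?thesis by (simp add: c_def)
    qed simp
  qed simp_all
qed

text \<open>If the right-hand sides of a solvable system are values of the terms \<open>ts\<close>, then the terms
  \<open>Sol rows j ts\<close>, for varying \<open>j\<close>, name a solution.\<close>

lemma pure_in_term_values:
  assumes A: "left_module R A"
  shows "pure_in R (range (term_value R A f)) A"
  unfolding pure_in_def
proof (intro allI impI)
  let ?v = "term_value R A f"
  fix rows c assume c: "range c \<subseteq> carrier A" and rhs: "\<forall>r\<in>set rows. row_value A r c \<in> range ?v"
  obtain name where name: "\<And>y. y \<in> range ?v \<Longrightarrow> ?v (name y) = y"
    by (metis f_inv_into_f)
  define ts where "ts = map (\<lambda>r. name (row_value A r c)) rows"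
  have ts: "map ?v ts = map (\<lambda>r. row_value A r c) rows"
    using rhs name by (simp add: ts_def)
  have ex: "\<exists>c. solves A rows (map ?v ts) c"
    using c ts by (auto simp: solves_def)
  define c' where "c' = (SOME c. solves A rows (map ?v ts) c)"
  have c': "solves A rows (map ?v ts) c'"
    unfolding c'_def using ex by (rule someI_ex)
  have "c' j = ?v (Sol rows j ts)" for j
    using ex by (simp add: c'_def)
  then have "range c' \<subseteq> range ?v" by blast
  moreover have "\<forall>r\<in>set rows. row_value A r c' = row_value A r c"
    using c' ts by (simp add: solves_def)
  ultimately show "\<exists>c'. range c' \<subseteq> range ?v \<and> (\<forall>r\<in>set rows. row_value A r c' = row_value A r c)"
    by blast
qed

text \<open>The values of terms form a pure submodule of \<open>A\<close> that contains the image of \<open>f\<close>. Replacing each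
  value by the code of a term for it gives an isomorphic module \<open>N\<close> whose elements are words over
  \<open>'r + 'm\<close>. So the possible \<open>N\<close> are confined to a type that does not depend on \<open>A\<close>, which is the size
  bound on which the existence of preenvelopes rests.\<close>

lemma factor_through_small:
  fixes R :: "'r ring" and M :: "('r, 'm) module" and A :: "('r, 'd) module"
  assumes M: "left_module R M" and A: "A \<in> WI_le R n" and f: "f \<in> mod_hom R M A"
  obtains N :: "('r, ('r + 'm) list) module" and \<phi> h
  where "N \<in> WI_le R n" "\<phi> \<in> mod_hom R M N" "h \<in> mod_hom R N A"
    "\<And>x. x \<in> carrier M \<Longrightarrow> f x = h (\<phi> x)"
proof -
  have lA: "left_module R A" using A by (simp add: WI_le_def)
  interpret A: left_module R A by (rule lA)
  let ?v = "term_value R A f"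
  let ?B = "A\<lparr>carrier := range ?v\<rparr>"
  have D: "range ?v \<subseteq> carrier A"
    using term_value_closed[OF lA] by blast
  have lB: "left_module R ?B"
  proof (rule A.left_module_submodule[OF D])
    show "\<zero>\<^bsub>A\<^esub> \<in> range ?v"
      by (rule range_eqI[of _ _ "Smult \<zero>\<^bsub>R\<^esub> (Gen undefined)"]) simp
    fix x y assume "x \<in> range ?v" "y \<in> range ?v"
    then obtain s t where "x = ?v s" "y = ?v t" by blast
    then show "x \<oplus>\<^bsub>A\<^esub> y \<in> range ?v" by (intro range_eqI[of _ _ "Add s t"]) simp
  next
    fix a x assume "a \<in> carrier R" "x \<in> range ?v"
    then obtain t where "a \<in> carrier R" "x = ?v t" by blast
    then show "a \<odot>\<^bsub>A\<^esub> x \<in> range ?v" by (intro range_eqI[of _ _ "Smult a t"]) simp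
  qed
  have fD: "f x \<in> range ?v" if "x \<in> carrier M" for x
    by (rule range_eqI[of _ _ "Gen x"]) (use mod_hom_closed[OF f that] in simp)
  define j where "j y = encode_term (inv_into UNIV ?v y)" for y
  have j: "inj_on j (range ?v)"
  proof (rule inj_onI)
    fix x y assume "x \<in> range ?v" "y \<in> range ?v" "j x = j y"
    then show "x = y"
      unfolding j_def by (metis injD[OF inj_encode_term] f_inv_into_f)
  qed
  then have jB: "inj_on j (carrier ?B)" by simp
  let ?N = "transport_mod j ?B" and ?h = "inv_into (carrier ?B) j"
  have hB: "?h \<in> mod_hom R ?N ?B" by (rule transport_mod_hom_inv[OF lB jB])
  have incl: "(\<lambda>x. x) \<in> mod_hom R ?B A" by (rule mod_homI) (use D in auto)
  have h: "?h \<in> mod_hom R ?N A" by (rule mod_hom_comp[OF hB incl])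
  have img: "?h ` carrier ?N = range ?v"
    using jB by (simp add: transport_mod_def image_image)
  have injh: "inj_on ?h (carrier ?N)"
    by (simp add: transport_mod_def inj_on_inv_into)
  show ?thesis
  proof
    show "?N \<in> WI_le R n"
      by (rule WI_le_pure[OF A left_module_transport_mod[OF lB jB] h injh])
        (simp only: img pure_in_term_values[OF lA])
    have "f \<in> mod_hom R M ?B"
      by (rule mod_homI) (use fD mod_hom_add[OF f] mod_hom_smult[OF f] in simp_all)
    then show "(\<lambda>x. j (f x)) \<in> mod_hom R M ?N"
      by (rule mod_hom_comp[OF _ transport_mod_hom[OF jB]])
    show "?h \<in> mod_hom R ?N A" by (rule h)
    show "f x = ?h (j (f x))" if "x \<in> carrier M" for x
      using inv_into_f_f[OF jB] fD[OF that] by simp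
  qed
qed

section \<open>The preenvelope\<close>

text \<open>An isomorphic copy of \<open>A\<close> is embedded in \<open>A\<close> with image \<open>A\<close>, which is trivially pure.\<close>

lemma WI_le_transport_mod:
  fixes R :: "'r ring"
  assumes A: "A \<in> WI_le R n" and j: "inj_on j (carrier A)"
  shows "transport_mod j A \<in> WI_le R n"
proof (rule WI_le_pure[OF A])
  have lA: "left_module R A" using A by (simp add: WI_le_def)
  show "left_module R (transport_mod j A)" by (rule left_module_transport_mod[OF lA j])
  show "inv_into (carrier A) j \<in> mod_hom R (transport_mod j A) A"
    by (rule transport_mod_hom_inv[OF lA j])
  show "inj_on (inv_into (carrier A) j) (carrier (transport_mod j A))"
    by (simp add: transport_mod_def inj_on_inv_into)
  have "inv_into (carrier A) j ` carrier (transport_mod j A) = carrier A"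
    using j by (simp add: transport_mod_def image_image)
  then show "pure_in R (inv_into (carrier A) j ` carrier (transport_mod j A)) A"
    by (simp add: pure_in_carrier)
qed

text \<open>For the second assertion, small modules are all that matters: a map from \<open>M\<close> into a test module on
  any type factors through one of them, and each of them has a copy on the type of \<open>C\<close>.\<close>

theorem theorem4p8:
  fixes R :: "'r ring" and n :: nat and M :: "('r, 'm) module"
  assumes "ring R" and "left_module R M"
  shows "(\<exists>(C :: ('r, ('r, 'm) preenv) module) \<phi>.
            preenvelope R (WI_le R n) (WI_le R n :: ('r, ('r, 'm) preenv) module set) M C \<phi>) \<and>
         (\<forall>(C :: ('r, ('r, 'm) preenv) module) \<phi>.
            preenvelope R (WI_le R n) (WI_le R n :: ('r, ('r, 'm) preenv) module set) M C \<phi> \<longrightarrow>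
            preenvelope R (WI_le R n) (WI_le R n :: ('r, 'd) module set) M C \<phi>)"
proof (intro conjI allI impI)
  define I :: "(('r, ('r + 'm) list) module \<times> ('m \<Rightarrow> ('r + 'm) list)) set"
    where "I = {(N, \<phi>). N \<in> WI_le R n \<and> \<phi> \<in> mod_hom R M N}"
  \<comment> \<open>One factor for each map from \<open>M\<close> to a small module, so that the projection onto that factor
    extends the map along \<open>?\<Phi>\<close>.\<close>
  let ?C = "prod_mod I fst" and ?\<Phi> = "\<lambda>x. \<lambda>i\<in>I. snd i x"
  have C: "?C \<in> WI_le R n"
    by (rule WI_le_prod_mod[OF assms(1)]) (auto simp: I_def)
  have \<Phi>: "?\<Phi> \<in> mod_hom R M ?C"
    by (rule prod_mod_tuple_hom[OF assms(2)]) (auto simp: I_def)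
  have "preenvelope R (WI_le R n) (WI_le R n :: ('r, ('r, 'm) preenv) module set) M ?C ?\<Phi>"
    unfolding preenvelope_def
  proof (intro conjI ballI C \<Phi>)
    fix C' :: "('r, ('r, 'm) preenv) module" and f
    assume C': "C' \<in> WI_le R n" and f: "f \<in> mod_hom R M C'"
    obtain N :: "('r, ('r + 'm) list) module" and \<phi> h
      where N: "N \<in> WI_le R n" and \<phi>: "\<phi> \<in> mod_hom R M N" and h: "h \<in> mod_hom R N C'"
        and fh: "\<And>x. x \<in> carrier M \<Longrightarrow> f x = h (\<phi> x)"
      using factor_through_small[OF assms(2) C' f] by metis
    have i: "(N, \<phi>) \<in> I" using N \<phi> by (simp add: I_def)
    have proj: "(\<lambda>x. x (N, \<phi>)) \<in> mod_hom R ?C N"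
      using prod_mod_proj_hom[OF i, of R fst] by simp
    show "\<exists>g\<in>mod_hom R ?C C'. \<forall>x\<in>carrier M. f x = g (?\<Phi> x)"
      by (intro bexI[of _ "\<lambda>x. h (x (N, \<phi>))"] ballI mod_hom_comp[OF proj h]) (simp add: i fh)
  qed
  then show "\<exists>(C :: ('r, ('r, 'm) preenv) module) \<phi>.
      preenvelope R (WI_le R n) (WI_le R n :: ('r, ('r, 'm) preenv) module set) M C \<phi>"
    by (intro exI)
next
  fix C :: "('r, ('r, 'm) preenv) module" and \<Phi>
  assume pre: "preenvelope R (WI_le R n) (WI_le R n :: ('r, ('r, 'm) preenv) module set) M C \<Phi>"
  show "preenvelope R (WI_le R n) (WI_le R n :: ('r, 'd) module set) M C \<Phi>"
    unfolding preenvelope_def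
  proof (intro conjI ballI)
    show "C \<in> WI_le R n" "\<Phi> \<in> mod_hom R M C" using pre by (simp_all add: preenvelope_def)
    fix C' :: "('r, 'd) module" and f
    assume C': "C' \<in> WI_le R n" and f: "f \<in> mod_hom R M C'"
    obtain N :: "('r, ('r + 'm) list) module" and \<phi> h
      where N: "N \<in> WI_le R n" and \<phi>: "\<phi> \<in> mod_hom R M N" and h: "h \<in> mod_hom R N C'"
        and fh: "\<And>x. x \<in> carrier M \<Longrightarrow> f x = h (\<phi> x)"
      using factor_through_small[OF assms(2) C' f] by metis
    \<comment> \<open>The assumption on \<open>C\<close> concerns test modules on its own type only. It applies to a copy of
      \<open>N\<close> on that type, given by constant families.\<close>
    let ?j = "\<lambda>u. (\<lambda>_. u) :: ('r, 'm) preenv"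
    have j: "inj_on ?j (carrier N)" by (rule inj_onI) (simp add: fun_eq_iff)
    have lN: "left_module R N" using N by (simp add: WI_le_def)
    let ?N = "transport_mod ?j N"
    obtain g where g: "g \<in> mod_hom R C ?N" and \<phi>g: "\<forall>x\<in>carrier M. ?j (\<phi> x) = g (\<Phi> x)"
      using pre[unfolded preenvelope_def, THEN conjunct2, THEN conjunct2, rule_format,
          OF WI_le_transport_mod[OF N j] mod_hom_comp[OF \<phi> transport_mod_hom[OF j]]]
      by (elim bexE)
    let ?k = "inv_into (carrier N) ?j"
    show "\<exists>g\<in>mod_hom R C C'. \<forall>x\<in>carrier M. f x = g (\<Phi> x)"
    proof (intro bexI[of _ "\<lambda>x. h (?k (g x))"] ballI)
      show "(\<lambda>x. h (?k (g x))) \<in> mod_hom R C C'"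
        by (rule mod_hom_comp[OF mod_hom_comp[OF g transport_mod_hom_inv[OF lN j]] h])
      fix x assume x: "x \<in> carrier M"
      have "?k (g (\<Phi> x)) = \<phi> x"
        using \<phi>g x inv_into_f_f[OF j mod_hom_closed[OF \<phi> x]] by simp
      then show "f x = h (?k (g (\<Phi> x)))" using fh[OF x] by simp
    qed
  qed
qed

end
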